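(* Let $\Phi=\{\varphi_i\}_{i\in I}$ and $\Psi=\{\psi_j\}_{j\in J}$ be two IFSs on $\mathbb{R}^d$, with self-similar sets $E$ and $F$ respectively, where $F$ is non-trivial (i.e. $F$ is not a single point). For $j\in J$ let $r_j'$ denote the contraction ratio of $\psi_j$. Suppose that the following properties hold: 1. $\Phi$ satisfies the strong separation condition. 2. There exist $r_1,r_2\in(0,1)$ and $I_1,I_2\subset I$ such that $\Phi=\{\varphi_{i,1}=r_1O_{i,1}+t_{i,1}\}_{i\in I_1}\cup\{\varphi_{i,2}=r_2O_{i,2}+t_{i,2}\}_{i\in I_2}$, where the $O_{i,1},O_{i,2}$ are $d\times d$ orthogonal matrices and $t_{i,1},t_{i,2}\in\mathbb{R}^d$ (that is, every similarity in $\Phi$ has contraction ratio $r_1$ or $r_2$). 3. There exists $j^*\in J$ such that: (a) $\psi_{j^*}=r_{j^*}'I_d+t_{j^*}$ for some $t_{j^*}\in\mathbb{R}^d$, where $I_d$ is the $d\times d$ identity matrix; (b) $-\frac{\log r_1}{\log r_{j^*}'}$ is irrational and not a Liouville number, and $-\frac{\log r_2}{\log r_{j^*}'}$ is a Liouville number. If $\dim_H(E)<\frac{1}{2}$, then $F$ cannot be affinely embedded into $E$.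
   Context: A map $\varphi:\mathbb{R}^d\to\mathbb{R}^d$ is a similarity if $\varphi(x)=r\,Ox+t$ for some $r\in(0,1)$ (its contraction ratio), some $d\times d$ orthogonal matrix $O$ and some $t\in\mathbb{R}^d$; this is abbreviated $\varphi=r\cdot O+t$. An iterated function system (IFS) is a finite set $\Phi=\{\varphi_i\}_{i\in I}$ of similarities of $\mathbb{R}^d$; its self-similar set is the unique non-empty compact set $K\subset\mathbb{R}^d$ with $K=\bigcup_{i\in I}\varphi_i(K)$. $\Phi$ satisfies the strong separation condition if its self-similar set $K$ satisfies $\varphi_i(K)\cap\varphi_j(K)=\emptyset$ for all $i\neq j$ in $I$. For $A,B\subset\mathbb{R}^d$, $A$ can be affinely embedded into $B$ if there is a map $f:\mathbb{R}^d\to\mathbb{R}^d$ of the form $f(x)=Mx+a$, with $M$ an invertible $d\times d$ matrix and $a\in\mathbb{R}^d$, such that $f(A)\subset B$. For real $\tau\geq 2$, $W(\tau)$ denotes the set of $x\in\mathbb{R}\setminus\mathbb{Q}$ for which there exist infinitely many $(p,q)\in\mathbb{Z}\times\mathbb{N}$ (with $q\geq 1$) satisfying $\left|x-\frac{p}{q}\right|<\frac{1}{q^{\tau}}$. For $x\in\mathbb{R}\setminus\mathbb{Q}$ the exact order of $x$ is $\tau(x):=\sup\{\tau\geq 2: x\in W(\tau)\}\in[2,\infty]$. An irrational $x$ is called a Liouville number if $\tau(x)=\infty$. $\dim_H$ denotes Hausdorff dimension. *)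

theory Defs
  imports "HOL-Analysis.Analysis"
begin

section \<open>Iterated function systems of similarities\<close>

text \<open>
  The contraction ratio of a similarity is determined by the map, since
  \<open>real ^ 'd\<close> has positive dimension; it is nevertheless kept as an explicit argument.
\<close>

definition similarity_with_ratio :: "real \<Rightarrow> (real ^ 'd \<Rightarrow> real ^ 'd) \<Rightarrow> bool" where
  "similarity_with_ratio r f \<longleftrightarrow>
     0 < r \<and> r < 1 \<and>
     (\<exists>U :: real ^ 'd ^ 'd. \<exists>t. orthogonal_matrix U \<and> f = (\<lambda>x. r *\<^sub>R (U *v x) + t))"

definition ifs :: "'i set \<Rightarrow> ('i \<Rightarrow> real ^ 'd \<Rightarrow> real ^ 'd) \<Rightarrow> bool" where
  "ifs I \<phi> \<longleftrightarrow> finite I \<and> (\<forall>i\<in>I. \<exists>r. similarity_with_ratio r (\<phi> i))"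

definition self_similar_set ::
    "'i set \<Rightarrow> ('i \<Rightarrow> real ^ 'd \<Rightarrow> real ^ 'd) \<Rightarrow> (real ^ 'd) set \<Rightarrow> bool" where
  "self_similar_set I \<phi> K \<longleftrightarrow> K \<noteq> {} \<and> compact K \<and> K = (\<Union>i\<in>I. \<phi> i ` K)"

text \<open>
  For an IFS the self-similar set is unique by Hutchinson's theorem, so the existential
  quantifier merely names it.
\<close>

definition strong_separation :: "'i set \<Rightarrow> ('i \<Rightarrow> real ^ 'd \<Rightarrow> real ^ 'd) \<Rightarrow> bool" where
  "strong_separation I \<phi> \<longleftrightarrow>
     (\<exists>K. self_similar_set I \<phi> K \<and>
          (\<forall>i\<in>I. \<forall>j\<in>I. i \<noteq> j \<longrightarrow> \<phi> i ` K \<inter> \<phi> j ` K = {}))"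

definition affinely_embeds :: "(real ^ 'd) set \<Rightarrow> (real ^ 'd) set \<Rightarrow> bool" where
  "affinely_embeds A B \<longleftrightarrow>
     (\<exists>M :: real ^ 'd ^ 'd. \<exists>a. invertible M \<and> (\<lambda>x. M *v x + a) ` A \<subseteq> B)"

section \<open>Exact approximation order and Liouville numbers\<close>

definition W :: "real \<Rightarrow> real set" where
  "W \<tau> = {x. x \<notin> \<rat> \<and>
     infinite {(p :: int, q :: nat). q \<ge> 1 \<and> \<bar>x - of_int p / real q\<bar> < 1 / real q powr \<tau>}}"

definition exact_order :: "real \<Rightarrow> ereal" where
  "exact_order x = (SUP \<tau>\<in>{\<tau>. 2 \<le> \<tau> \<and> x \<in> W \<tau>}. ereal \<tau>)"

definition liouville :: "real \<Rightarrow> bool" where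
  "liouville x \<longleftrightarrow> x \<notin> \<rat> \<and> exact_order x = \<infinity>"

section \<open>Hausdorff dimension\<close>

text \<open>
  Covers are by bounded sets because \<^const>\<open>diameter\<close> has no meaningful value on unbounded ones.
  The definitions are only used for \<open>s > 0\<close>: there \<open>0 powr s = 0\<close> is the correct contribution
  of an empty or one-point set (at \<open>s = 0\<close> it would not be the counting measure). Leaving out
  \<open>s = 0\<close> does not change the infimum that defines the dimension.
\<close>

definition hausdorff_premeasure :: "real \<Rightarrow> real \<Rightarrow> 'a :: metric_space set \<Rightarrow> ennreal" where
  "hausdorff_premeasure s \<delta> A =
     (INF U \<in> {U :: nat \<Rightarrow> 'a set. A \<subseteq> (\<Union>n. U n) \<and> (\<forall>n. bounded (U n) \<and> diameter (U n) \<le> \<delta>)}.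
        \<Sum>n. ennreal (diameter (U n) powr s))"

definition hausdorff_measure :: "real \<Rightarrow> 'a :: metric_space set \<Rightarrow> ennreal" where
  "hausdorff_measure s A = (SUP \<delta>\<in>{0<..}. hausdorff_premeasure s \<delta> A)"

definition hausdorff_dim :: "'a :: metric_space set \<Rightarrow> ereal" where
  "hausdorff_dim A = (INF s\<in>{s. 0 < s \<and> hausdorff_measure s A = 0}. ereal s)"

end

theory Submission
  imports Defs
begin

text \<open>
  Write \<open>\<rho>\<close> for the contraction ratio of the map \<open>\<psi> j\<^sub>0\<close>, which has no rotational part. If \<open>p\<close> is
  its fixed point and \<open>q \<noteq> p\<close> is another point of \<open>F\<close>, then \<open>F\<close> contains the geometric sequence
  \<open>p + \<rho>\<^sup>n (q - p)\<close>, so an affine copy of \<open>F\<close> inside \<open>E\<close> makes \<open>E\<close> contain points at the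
  distances \<open>\<rho>\<^sup>n d\<close> from some \<open>y \<in> E\<close>, where \<open>d > 0\<close>. Following the coding of \<open>y\<close> in the dust-like set
  \<open>E\<close>, one can magnify these pairs of points: a pair whose distance is small compared with the
  \<open>m\<close>-th cylinder around \<open>y\<close> lies in that cylinder, and pulling it back shows that
  \<open>\<rho>\<^sup>n d / (r\<^sub>1\<^sup>a r\<^sub>2\<^sup>b)\<close> is again a distance between points of \<open>E\<close>, where \<open>a\<close> and \<open>b\<close> count the
  occurrences of the two ratios among the first \<open>m\<close> letters
  (\<open>rescaled_distances\<close>). Choose \<open>n\<close> such that this number is comparable with the gap of \<open>E\<close>, take
  logarithms and divide by \<open>ln \<rho>\<close>: modulo \<open>1\<close> and up to a constant, one obtains
  \<open>a \<alpha> + b \<beta>\<close> with \<open>\<alpha> = - ln r\<^sub>1 / ln \<rho>\<close> and \<open>\<beta> = - ln r\<^sub>2 / ln \<rho>\<close>. As \<open>m\<close> grows this is a path on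
  the circle, each step of which is a rotation by \<open>\<alpha>\<close> or by \<open>\<beta>\<close>.

  Two opposite estimates now collide. On the one hand, the distance set of \<open>E\<close> is small: the
  self-similarity of \<open>E\<close> turns vanishing of the \<open>s\<close>-dimensional Hausdorff measure into the bound
  \<open>C \<delta>\<^sup>-\<^sup>s\<close> for covering numbers (\<open>null_measure_imp_covering_exponent\<close>), hence
  a \<open>\<delta>\<close>-separated set of distances has at most \<open>C \<delta>\<^sup>-\<^sup>2\<^sup>s\<close> elements, and \<open>2 s < 1\<close> is possible because
  the dimension is below \<open>1/2\<close>.

  On the other hand, any such path has full upper box dimension: for every \<open>s < 1\<close> there are scales
  \<open>\<delta>\<close> at which it has more than \<open>C \<delta>\<^sup>-\<^sup>s\<close> separated points (\<open>two_step_path_separated_points\<close>). This is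
  where the contrast between \<open>\<alpha>\<close> and \<open>\<beta>\<close> enters. Let \<open>p / q\<close> be extremely close to \<open>\<beta>\<close>. If the
  path makes \<open>q\<close> consecutive steps \<open>\<beta>\<close>, these already give \<open>q\<close> points that are \<open>1 / (2 q)\<close>-separated.
  Otherwise steps \<open>\<alpha>\<close> occur at least once in any \<open>q\<close> steps. Multiplication by \<open>q\<close> then makes the
  contribution of \<open>\<beta>\<close> negligible for a very long time, during which the path follows the
  multiples of \<open>q \<alpha>\<close>. By Dirichlet's theorem these are well separated up to some \<open>Q\<close>, about \<open>1 / Q\<close>
  apart; since \<open>\<alpha>\<close> is not a Liouville number, \<open>Q\<close> can be made larger than any prescribed power of
  \<open>q\<close>, so that the loss of the factor \<open>q\<close> in the scale does not matter, while the Liouville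
  property of \<open>\<beta>\<close> controls the error up to the time needed to make \<open>Q\<close> steps \<open>\<alpha>\<close>.
\<close>

section \<open>Approximation of non-Liouville and Liouville numbers\<close>

text \<open>
  Only finitely many fractions approximate \<open>\<alpha>\<close> with an exponent above its exact order; a small
  enough constant takes care of them.
\<close>
lemma non_liouville_lower_bound:
  assumes "\<alpha> \<notin> \<rat>" "\<not> liouville \<alpha>"
  obtains c :: real and t :: nat
  where "c > 0" "\<And>(p :: int) q :: int. q > 0 \<Longrightarrow> c / of_int q ^ t \<le> \<bar>of_int q * \<alpha> - of_int p\<bar>"
proof -
  obtain T where T: "exact_order \<alpha> \<le> ereal T"
  proof -
    have "exact_order \<alpha> < \<infinity>"
      using assms by (auto simp: liouville_def)
    then show thesis
      using that by (cases "exact_order \<alpha>") auto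
  qed
  define t where "t = nat \<lceil>max 2 (T + 1)\<rceil>"
  have t: "real t \<ge> 2" "real t > T"
    unfolding t_def by linarith+
  have "\<alpha> \<notin> W (real t)"
  proof
    assume "\<alpha> \<in> W (real t)"
    then have "ereal (real t) \<le> exact_order \<alpha>"
      unfolding exact_order_def using t by (intro SUP_upper) auto
    from this T have "ereal (real t) \<le> ereal T"
      by (rule order_trans)
    then show False
      using t by simp
  qed
  define X where "X = {(p :: int, q :: nat). q \<ge> 1 \<and> \<bar>\<alpha> - of_int p / real q\<bar> < 1 / real q powr real t}"
  have fin: "finite X"
    using \<open>\<alpha> \<notin> W (real t)\<close> assms unfolding W_def X_def by auto
  define c where "c = Min (insert 1 ((\<lambda>(p, q). \<bar>\<alpha> - of_int p / real q\<bar>) ` X))"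
  have "c > 0"
    using fin assms by (auto simp: c_def)
  have "c \<le> 1"
    using fin by (auto simp: c_def)
  have bound: "c / of_int q ^ t \<le> \<bar>of_int q * \<alpha> - of_int p\<bar>" if "q > 0" for p q :: int
  proof -
    define n where "n = nat q"
    have n: "n \<ge> 1" "real n = of_int q"
      using that by (auto simp: n_def)
    have q1: "of_int q ^ t \<ge> (1 :: real)"
      using that by (intro one_le_power) auto
    have "c / of_int q ^ t \<le> \<bar>\<alpha> - of_int p / real n\<bar>"
    proof (cases "(p, n) \<in> X")
      case True
      then have "c \<le> \<bar>\<alpha> - of_int p / real n\<bar>"
        unfolding c_def using fin by (intro Min_le) auto
      moreover have "c / of_int q ^ t \<le> c"
        using q1 \<open>c > 0\<close> by (simp add: field_simps)
      ultimately show ?thesis by linarith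
    next
      case False
      then have "1 / of_int q ^ t \<le> \<bar>\<alpha> - of_int p / real n\<bar>"
        using n by (auto simp: X_def powr_realpow)
      moreover have "c / of_int q ^ t \<le> 1 / of_int q ^ t"
        using \<open>c \<le> 1\<close> q1 by (intro divide_right_mono) auto
      ultimately show ?thesis by linarith
    qed
    also have "\<dots> \<le> real n * \<bar>\<alpha> - of_int p / real n\<bar>"
      using mult_right_mono[of 1 "real n" "\<bar>\<alpha> - of_int p / real n\<bar>"] n(1) by simp
    also have "\<dots> = \<bar>real n * (\<alpha> - of_int p / real n)\<bar>"
      by (simp add: abs_mult)
    also have "real n * (\<alpha> - of_int p / real n) = of_int q * \<alpha> - of_int p"
      using n by (simp add: field_simps)
    finally show ?thesis .
  qed
  show thesis
    by (rule that[OF \<open>c > 0\<close> bound])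
qed

text \<open>
  Cancelling common factors only improves the approximation, since the denominator decreases. The
  reduced denominators still tend to infinity: an irrational number keeps a positive distance from
  all fractions with bounded denominators.
\<close>
lemma liouville_coprime_approximation:
  fixes Q T :: nat
  assumes "liouville \<beta>" "T \<ge> 1"
  obtains p q :: int
  where "coprime p q" "q > 0" "q \<ge> int Q" "\<bar>of_int q * \<beta> - of_int p\<bar> * of_int q ^ T < 1"
proof -
  have irr: "\<beta> \<notin> \<rat>" and inf: "exact_order \<beta> = \<infinity>"
    using assms by (auto simp: liouville_def)
  \<comment> \<open>The multiples of \<open>\<beta>\<close> up to the \<open>Q\<close>-th miss the integers by the margin \<open>\<mu>\<close>.\<close>
  define \<mu> where "\<mu> = Min (insert 1 ((\<lambda>k. \<bar>of_int k * \<beta> - of_int (round (of_int k * \<beta>))\<bar>) ` {1..int Q}))"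
  have "of_int k * \<beta> \<noteq> of_int l" if "k \<ge> 1" for k l :: int
  proof
    assume "of_int k * \<beta> = of_int l"
    then have "\<beta> = of_int l / of_int k"
      using that by (simp add: field_simps)
    then show False
      using irr by simp
  qed
  then have "\<mu> > 0"
    by (auto simp: \<mu>_def)
  have margin: "\<mu> \<le> \<bar>of_int k * \<beta> - of_int l\<bar>" if "1 \<le> k" "k \<le> int Q" for k l :: int
  proof -
    have "\<mu> \<le> \<bar>of_int k * \<beta> - of_int (round (of_int k * \<beta>))\<bar>"
      unfolding \<mu>_def using that by (intro Min_le) auto
    also have "\<dots> \<le> \<bar>of_int k * \<beta> - of_int l\<bar>"
      using round_diff_minimal[of "of_int k * \<beta>" l] by (simp add: abs_minus_commute)
    finally show ?thesis .
  qed
  \<comment> \<open>One more than \<open>T\<close>, as the error is multiplied by the denominator.\<close>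
  obtain \<tau> where \<tau>: "\<tau> > real T + 1" "\<beta> \<in> W \<tau>"
  proof -
    have "ereal (real T + 1) < exact_order \<beta>"
      using inf by simp
    then show thesis
      using that unfolding exact_order_def less_SUP_iff by auto
  qed
  \<comment> \<open>An unreduced denominator above \<open>1 / \<mu>\<close> makes the error smaller than the margin \<open>\<mu>\<close>.\<close>
  define B where "B = nat \<lceil>1 / \<mu>\<rceil> + 1"
  define X where "X = {(p :: int, q :: nat). q \<ge> 1 \<and> \<bar>\<beta> - of_int p / real q\<bar> < 1 / real q powr \<tau>}"
  have "infinite X"
    using \<tau> by (auto simp: W_def X_def)
  have "\<not> X \<subseteq> {- \<lceil>(\<bar>\<beta>\<bar> + 1) * real B\<rceil>..\<lceil>(\<bar>\<beta>\<bar> + 1) * real B\<rceil>} \<times> {..B}"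
    using \<open>infinite X\<close> finite_subset by blast
  then obtain p0 q0 where pq0: "(p0, q0) \<in> X"
      and out: "\<bar>p0\<bar> > \<lceil>(\<bar>\<beta>\<bar> + 1) * real B\<rceil> \<or> q0 > B"
    by fastforce
  have q0: "q0 \<ge> 1" and approx: "\<bar>\<beta> - of_int p0 / real q0\<bar> < 1 / real q0 powr \<tau>"
    using pq0 by (auto simp: X_def)
  have pw: "real q0 powr \<tau> \<ge> real q0 * real q0 ^ T"
  proof -
    have "real q0 * real q0 ^ T = real q0 powr (real T + 1)"
      using q0 by (simp add: powr_add powr_realpow)
    also have "\<dots> \<le> real q0 powr \<tau>"
      using q0 \<tau> by (intro powr_mono) auto
    finally show ?thesis .
  qed
  have "real q0 * real q0 ^ T \<ge> 1 * 1"
    using q0 by (intro mult_mono one_le_power) auto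
  have "\<bar>\<beta> - of_int p0 / real q0\<bar> < 1 / (real q0 * real q0 ^ T)"
    using approx pw \<open>real q0 * real q0 ^ T \<ge> 1 * 1\<close>
    by (smt (verit) frac_le)
  then have ap: "\<bar>\<beta> - of_int p0 / real q0\<bar> * (real q0 * real q0 ^ T) < 1"
    using q0 by (simp add: field_simps)
  have q0B: "q0 > B"
  proof (rule ccontr)
    assume "\<not> q0 > B"
    then have "\<bar>p0\<bar> > \<lceil>(\<bar>\<beta>\<bar> + 1) * real B\<rceil>"
      using out by simp
    then have "real_of_int \<bar>p0\<bar> > (\<bar>\<beta>\<bar> + 1) * real B"
      by linarith
    moreover have "(\<bar>\<beta>\<bar> + 1) * real q0 \<le> (\<bar>\<beta>\<bar> + 1) * real B"
      using \<open>\<not> q0 > B\<close> by (intro mult_left_mono) auto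
    ultimately have "(\<bar>\<beta>\<bar> + 1) * real q0 < \<bar>real_of_int p0\<bar>"
      by simp
    then have "\<bar>of_int p0 / real q0\<bar> > \<bar>\<beta>\<bar> + 1"
      using q0 by (simp add: less_divide_eq)
    then have "\<bar>\<beta> - of_int p0 / real q0\<bar> > 1"
      by linarith
    then show False
      using ap \<open>real q0 * real q0 ^ T \<ge> 1 * 1\<close>
      by (smt (verit) mult_le_cancel_left1)
  qed
  define g where "g = gcd p0 (int q0)"
  have g: "g > 0"
    using q0 by (simp add: g_def)
  define p q where "p = p0 div g" and "q = int q0 div g"
  have pq: "p0 = p * g" "int q0 = q * g" "coprime p q"
    using q0 by (auto simp: p_def q_def g_def intro!: div_gcd_coprime)
  have q: "q > 0"
    using pq(2) q0 g by (smt (verit) mult_less_0_iff mult_zero_left of_nat_le_0_iff of_nat_less_0_iff not_one_le_zero zero_less_mult_iff)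
  have "q * 1 \<le> q * g"
    using q g by (intro mult_left_mono) auto
  then have qq0: "of_int q \<le> real q0"
    using pq(2) by (metis mult.right_neutral of_int_le_iff of_int_of_nat_eq)
  have "real q0 = of_int q * of_int g" "real_of_int p0 = of_int p * of_int g"
    using pq by (metis of_int_mult of_int_of_nat_eq)+
  then have frac: "of_int p0 / real q0 = of_int p / of_int q"
    using g by simp
  have eq: "\<bar>of_int q * \<beta> - of_int p\<bar> = \<bar>\<beta> - of_int p0 / real q0\<bar> * of_int q"
    unfolding frac using q by (simp add: abs_if field_simps)
  have "\<bar>of_int q * \<beta> - of_int p\<bar> * real q0 ^ T \<le> \<bar>\<beta> - of_int p0 / real q0\<bar> * (real q0 * real q0 ^ T)"
    unfolding eq using qq0 q by (simp add: mult.assoc mult_left_mono mult_right_mono)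
  also note ap
  finally have final: "\<bar>of_int q * \<beta> - of_int p\<bar> * real q0 ^ T < 1" .
  have "of_int q ^ T \<le> real q0 ^ T"
    using qq0 q by (intro power_mono) auto
  then have "\<bar>of_int q * \<beta> - of_int p\<bar> * of_int q ^ T \<le> \<bar>of_int q * \<beta> - of_int p\<bar> * real q0 ^ T"
    by (intro mult_left_mono) auto
  with final have goal: "\<bar>of_int q * \<beta> - of_int p\<bar> * of_int q ^ T < 1"
    by linarith
  have "q \<ge> int Q"
  proof (rule ccontr)
    assume "\<not> q \<ge> int Q"
    then have "\<mu> \<le> \<bar>of_int q * \<beta> - of_int p\<bar>"
      using q by (intro margin) auto
    also have "\<dots> \<le> \<bar>\<beta> - of_int p0 / real q0\<bar> * real q0"
      unfolding eq using qq0 by (intro mult_left_mono) auto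
    finally have "\<mu> * real q0 ^ T \<le> \<bar>\<beta> - of_int p0 / real q0\<bar> * (real q0 * real q0 ^ T)"
      by (simp add: mult_right_mono flip: mult.assoc)
    with ap have "\<mu> * real q0 ^ T < 1" by linarith
    moreover have "real q0 \<le> real q0 ^ T"
      using q0 \<open>T \<ge> 1\<close> by (intro self_le_power) auto
    moreover have "1 / \<mu> < real q0"
      using q0B unfolding B_def by linarith
    ultimately show False
      using \<open>\<mu> > 0\<close> by (smt (verit) mult_left_mono pos_divide_less_eq mult.commute)
  qed
  show thesis
    by (rule that[OF pq(3) q \<open>q \<ge> int Q\<close> goal])
qed

section \<open>Paths on the circle with two step lengths\<close>

definition circle_separated :: "real \<Rightarrow> 'a set \<Rightarrow> ('a \<Rightarrow> real) \<Rightarrow> bool" where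
  "circle_separated \<delta> M x \<longleftrightarrow>
     (\<forall>m\<in>M. \<forall>m'\<in>M. m \<noteq> m' \<longrightarrow> (\<forall>n :: int. \<delta> \<le> \<bar>x m - x m' - of_int n\<bar>))"

text \<open>
  The multiples \<open>j P / Q\<close> stay \<open>1 / Q\<close> away from the integers; replacing \<open>P / Q\<close> by \<open>\<theta>\<close> changes
  them by at most \<open>\<bar>j\<bar> \<eta> / Q\<close>. Both Diophantine inputs of the path argument are used in this form.
\<close>
lemma multiple_away_from_integers:
  fixes P Q j n :: int and \<theta> \<eta> :: real
  assumes "coprime P Q" "j \<noteq> 0" "\<bar>j\<bar> < Q" "\<bar>of_int Q * \<theta> - of_int P\<bar> \<le> \<eta>"
  shows "(1 - of_int \<bar>j\<bar> * \<eta>) / of_int Q \<le> \<bar>of_int j * \<theta> - of_int n\<bar>"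
proof -
  have Q: "Q > 0" using assms by linarith
  have "\<not> Q dvd j"
    using assms zdvd_imp_le[of Q "\<bar>j\<bar>"] by auto
  then have "\<not> Q dvd j * P"
    using assms(1) by (simp add: coprime_commute coprime_dvd_mult_left_iff)
  then have "j * P - n * Q \<noteq> 0"
    by auto
  then have "1 \<le> \<bar>j * P - n * Q\<bar>"
    by linarith
  then have "1 \<le> \<bar>real_of_int (j * P - n * Q)\<bar>"
    by linarith
  moreover have "\<bar>of_int j * (of_int Q * \<theta> - of_int P)\<bar> \<le> of_int \<bar>j\<bar> * \<eta>"
    unfolding abs_mult using assms by (intro mult_mono) auto
  moreover have "of_int Q * (of_int j * \<theta> - of_int n) =
      of_int j * (of_int Q * \<theta> - of_int P) + of_int (j * P - n * Q)"
    by (simp add: algebra_simps)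
  ultimately have "1 - of_int \<bar>j\<bar> * \<eta> \<le> \<bar>of_int Q * (of_int j * \<theta> - of_int n)\<bar>"
    by linarith
  also have "\<dots> = of_int Q * \<bar>of_int j * \<theta> - of_int n\<bar>"
    using Q by (simp add: abs_mult)
  finally show ?thesis
    using Q by (simp add: field_simps)
qed

text \<open>
  The first alternative for a path: in a run of \<open>q\<close> steps \<open>\<beta>\<close>, the points follow the multiples of
  \<open>p / q\<close> closely enough to keep half of their spacing \<open>1 / q\<close>.
\<close>
lemma run_separated:
  fixes p q :: int and x :: "nat \<Rightarrow> real"
  assumes "coprime p q" "\<bar>of_int q * \<beta> - of_int p\<bar> \<le> 1 / (2 * of_int q)"
    and run: "\<And>i. i < nat q \<Longrightarrow> x (n0 + i) = x n0 + real i * \<beta>"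
  shows "circle_separated (1 / (2 * of_int q)) {n0..<n0 + nat q} x"
  unfolding circle_separated_def
proof (intro ballI impI allI)
  fix m m' and n :: int
  assume m: "m \<in> {n0..<n0 + nat q}" "m' \<in> {n0..<n0 + nat q}" "m \<noteq> m'"
  define j where "j = int m - int m'"
  have j: "j \<noteq> 0" "\<bar>j\<bar> < q"
    using m by (auto simp: j_def)
  have "x m = x n0 + (real m - real n0) * \<beta>" "x m' = x n0 + (real m' - real n0) * \<beta>"
    using m run[of "m - n0"] run[of "m' - n0"] by (auto simp: of_nat_diff)
  then have eq: "x m - x m' - of_int n = of_int j * \<beta> - of_int n"
    by (simp add: j_def algebra_simps)
  have "of_int \<bar>j\<bar> * (1 / (2 * of_int q)) \<le> (1/2 :: real)"
    using j by (simp add: field_simps)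
  then have "(1 / 2) / of_int q \<le> (1 - of_int \<bar>j\<bar> * (1 / (2 * of_int q))) / real_of_int q"
    using j by (intro divide_right_mono) auto
  also have "\<dots> \<le> \<bar>of_int j * \<beta> - of_int n\<bar>"
    using assms j by (intro multiple_away_from_integers) auto
  finally show "1 / (2 * of_int q) \<le> \<bar>x m - x m' - of_int n\<bar>"
    unfolding eq by simp
qed

text \<open>
  The second alternative: \<open>y k\<close> is a point of the path after \<open>k\<close> steps \<open>\<alpha>\<close>. Multiplied by \<open>q\<close>, the
  differences of these points are, modulo \<open>1\<close>, multiples of \<open>q \<alpha>\<close> up to an error \<open>1 / (4 Q)\<close>
  caused by the steps \<open>\<beta>\<close>. Only \<open>k\<close> up to about \<open>Q / 2\<close> is used, so that half of the separation
  \<open>1 / Q\<close> of the fractions with denominator \<open>Q\<close> survives the passage to multiples of \<open>q \<alpha>\<close>.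
\<close>
lemma frequent_steps_separated:
  fixes p q P Q :: int and y :: "nat \<Rightarrow> real" and b :: "nat \<Rightarrow> nat"
  assumes q: "q > 0" and \<beta>: "4 * of_int Q ^ 2 * of_int q * \<bar>of_int q * \<beta> - of_int p\<bar> \<le> 1"
    and Q: "Q > 0" "coprime P Q" "\<bar>of_int Q * (of_int q * \<alpha>) - of_int P\<bar> \<le> 1 / of_int Q"
    and y: "\<And>k. y k = y0 + real k * \<alpha> + real (b k) * \<beta>"
    and b: "\<And>k. int k < Q \<Longrightarrow> int (b k) \<le> Q * q"
  shows "circle_separated (1 / (4 * of_int Q * of_int q)) {..<nat ((Q + 1) div 2)} y"
  unfolding circle_separated_def
proof (intro ballI impI allI)
  fix k k' and n :: int
  assume k: "k \<in> {..<nat ((Q + 1) div 2)}" "k' \<in> {..<nat ((Q + 1) div 2)}" "k \<noteq> k'"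
  define j where "j = int k - int k'"
  define l where "l = int (b k) - int (b k')"
  have "int k < (Q + 1) div 2" "int k' < (Q + 1) div 2"
    using k by auto
  then have "2 * int k + 1 \<le> Q" "2 * int k' + 1 \<le> Q"
    by presburger+
  then have j: "j \<noteq> 0" "2 * \<bar>j\<bar> \<le> Q" "\<bar>j\<bar> < Q"
    using k(3) by (auto simp: j_def abs_if)
  have "int k < Q" "int k' < Q"
    using k by auto
  then have l: "\<bar>l\<bar> \<le> Q * q"
    using b[of k] b[of k'] by (auto simp: l_def)
  have "2 * real_of_int \<bar>j\<bar> \<le> real_of_int Q"
    using j by linarith
  then have "of_int \<bar>j\<bar> * (1 / of_int Q) \<le> (1/2 :: real)"
    using Q by (simp add: field_simps)
  then have "(1 / 2) / of_int Q \<le> (1 - of_int \<bar>j\<bar> * (1 / of_int Q)) / real_of_int Q"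
    using Q by (intro divide_right_mono) auto
  also have "\<dots> \<le> \<bar>of_int j * (of_int q * \<alpha>) - of_int (n * q - l * p)\<bar>"
    using Q j by (intro multiple_away_from_integers) auto
  finally have 1: "1 / (2 * of_int Q) \<le> \<bar>of_int j * (of_int q * \<alpha>) - of_int (n * q - l * p)\<bar>"
    by simp
  have "\<bar>of_int l * (of_int q * \<beta> - of_int p)\<bar> \<le> of_int (Q * q) * \<bar>of_int q * \<beta> - of_int p\<bar>"
    unfolding abs_mult using l by (intro mult_right_mono) (auto simp flip: of_int_mult of_int_abs)
  also have "\<dots> \<le> 1 / (4 * of_int Q)"
    using \<beta> Q by (simp add: field_simps power2_eq_square)
  finally have 2: "\<bar>of_int l * (of_int q * \<beta> - of_int p)\<bar> \<le> 1 / (4 * of_int Q)" .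
  \<comment> \<open>The integer subtracted from the multiple of \<open>q \<alpha>\<close> absorbs the nearby integer \<open>l p\<close> of \<open>l q \<beta>\<close>.\<close>
  have "of_int q * (y k - y k' - of_int n) =
      (of_int j * (of_int q * \<alpha>) - of_int (n * q - l * p)) + of_int l * (of_int q * \<beta> - of_int p)"
    by (simp add: y j_def l_def algebra_simps)
  moreover have "1 / (2 * of_int Q) = 1 / (4 * of_int Q) + 1 / (4 * real_of_int Q)"
    by simp
  ultimately have "1 / (4 * of_int Q) \<le> \<bar>of_int q * (y k - y k' - of_int n)\<bar>"
    using 1 2 by linarith
  also have "\<dots> = of_int q * \<bar>y k - y k' - of_int n\<bar>"
    using q by (simp add: abs_mult)
  finally show "1 / (4 * of_int Q * of_int q) \<le> \<bar>y k - y k' - of_int n\<bar>"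
    using q Q by (simp add: field_simps)
qed

text \<open>
  If no run of \<open>q\<close> steps \<open>\<beta>\<close> occurs, each further step \<open>\<alpha>\<close> has to be awaited for fewer than \<open>q\<close>
  steps \<open>\<beta>\<close>.
\<close>
lemma frequent_steps_count:
  fixes x :: "nat \<Rightarrow> real"
  assumes step: "\<And>m. x (Suc m) = x m + \<alpha> \<or> x (Suc m) = x m + \<beta>"
    and frequent: "\<And>n. \<exists>i<q. x (Suc (n + i)) \<noteq> x (n + i) + \<beta>"
  shows "\<exists>m b. b \<le> k * q \<and> x m = x 0 + real k * \<alpha> + real b * \<beta>"
proof (induction k)
  case 0
  then show ?case by (intro exI[of _ 0]) auto
next
  case (Suc k)
  then obtain m b where mb: "b \<le> k * q" "x m = x 0 + real k * \<alpha> + real b * \<beta>"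
    by blast
  define i where "i = (LEAST i. x (Suc (m + i)) \<noteq> x (m + i) + \<beta>)"
  obtain i' where i': "i' < q" "x (Suc (m + i')) \<noteq> x (m + i') + \<beta>"
    using frequent by blast
  have i: "x (Suc (m + i)) \<noteq> x (m + i) + \<beta>"
    unfolding i_def by (rule LeastI, rule i')
  have "i < q"
    using i' Least_le[of "\<lambda>i. x (Suc (m + i)) \<noteq> x (m + i) + \<beta>" i'] unfolding i_def by linarith
  have "x (m + l) = x m + real l * \<beta>" if "l \<le> i" for l
    using that
  proof (induction l)
    case (Suc l)
    then have "x (Suc (m + l)) = x (m + l) + \<beta>"
      using not_less_Least[of l "\<lambda>i. x (Suc (m + i)) \<noteq> x (m + i) + \<beta>"] unfolding i_def by auto
    with Suc show ?case by (simp add: algebra_simps)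
  qed simp
  then have "x (Suc (m + i)) = x 0 + real (Suc k) * \<alpha> + real (b + i) * \<beta>"
    using i step[of "m + i"] mb by (auto simp: algebra_simps)
  then show ?case
    using mb \<open>i < q\<close> by (intro exI[of _ "Suc (m + i)"] exI[of _ "b + i"]) auto
qed

lemma circle_separated_reindex:
  assumes "circle_separated \<delta> K (\<lambda>k. x (f k))" "\<delta> > 0"
  shows "inj_on f K" "circle_separated \<delta> (f ` K) x"
proof -
  show "inj_on f K"
  proof (rule inj_onI, rule ccontr)
    fix k k' assume *: "k \<in> K" "k' \<in> K" "f k = f k'" "k \<noteq> k'"
    then have "\<delta> \<le> \<bar>x (f k) - x (f k') - of_int 0\<bar>"
      using assms(1) unfolding circle_separated_def by blast
    with * assms(2) show False by simp
  qed
  show "circle_separated \<delta> (f ` K) x"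
    unfolding circle_separated_def
  proof (intro ballI impI allI)
    fix m m' and n :: int
    assume "m \<in> f ` K" "m' \<in> f ` K" "m \<noteq> m'"
    then obtain k k' where "k \<in> K" "k' \<in> K" "k \<noteq> k'" "m = f k" "m' = f k'"
      by auto
    then show "\<delta> \<le> \<bar>x m - x m' - of_int n\<bar>"
      using assms(1) unfolding circle_separated_def by blast
  qed
qed

text \<open>
  The upper box dimension of such a path on the circle is \<open>1\<close>. The order of the choices matters:
  \<open>k\<close> depends on \<open>s\<close> and says how many powers of \<open>q\<close> the number \<open>Q\<close> must exceed; \<open>L\<close> is chosen such
  that Dirichlet's theorem with the bound \<open>q\<^sup>L\<close> forces \<open>Q > q\<^sup>k\<close>; the quality \<open>2 L + 4\<close> of the
  approximation to \<open>\<beta>\<close> covers the at most \<open>Q q\<close> steps \<open>\<beta>\<close> before \<open>Q\<close> steps \<open>\<alpha>\<close> are made; the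
  denominator \<open>q\<close> is taken last, beyond all constants.
\<close>
lemma two_step_path_separated_points:
  fixes x :: "nat \<Rightarrow> real" and s C :: real
  assumes \<alpha>: "\<alpha> \<notin> \<rat>" "\<not> liouville \<alpha>" and \<beta>: "liouville \<beta>"
    and step: "\<And>m. x (Suc m) = x m + \<alpha> \<or> x (Suc m) = x m + \<beta>"
    and s: "0 \<le> s" "s < 1" and C: "C > 0"
  obtains \<delta> M where "0 < \<delta>" "\<delta> \<le> 1" "finite M" "circle_separated \<delta> M x"
    "C * (1 / \<delta>) powr s < real (card M)"
proof -
  obtain c t where c: "c > 0"
    and diophantine: "\<And>(p :: int) q :: int. q > 0 \<Longrightarrow> c / of_int q ^ t \<le> \<bar>of_int q * \<alpha> - of_int p\<bar>"
    using non_liouville_lower_bound[OF \<alpha>] by metis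
  define k where "k = nat \<lceil>(s + 1) / (1 - s)\<rceil>"
  have k: "real k * (1 - s) \<ge> s + 1"
  proof -
    have "(s + 1) / (1 - s) \<le> real k"
      unfolding k_def by linarith
    then show ?thesis
      using s by (simp add: field_simps)
  qed
  define L where "L = (k + 1) * (t + 1) + 1"
  define Q0 where "Q0 = nat \<lceil>max (max 2 (1 / c)) (max ((2 * C) powr (1 / (1 - s))) (8 * C))\<rceil> + 1"
  have Q0: "real Q0 > 2" "real Q0 > 1 / c" "real Q0 > (2 * C) powr (1 / (1 - s))" "real Q0 > 8 * C"
    unfolding Q0_def by linarith+
  obtain p q :: int where pq: "coprime p q" "q > 0" "q \<ge> int Q0"
    and approx: "\<bar>of_int q * \<beta> - of_int p\<bar> * of_int q ^ (2 * L + 4) < 1"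
    using liouville_coprime_approximation[OF \<beta>, of "2 * L + 4" Q0] by auto
  define r where "r = real_of_int q"
  have "r \<ge> real Q0"
    using pq unfolding r_def by linarith
  then have r: "r > 2" "r > 1 / c" "r > (2 * C) powr (1 / (1 - s))" "r > 8 * C"
    using Q0 by linarith+
  have nq: "real (nat q) = r"
    using pq by (simp add: r_def)
  have approx': "\<bar>r * \<beta> - of_int p\<bar> * r ^ (2 * L + 4) < 1"
    using approx by (simp add: r_def)
  show thesis
  proof (cases "\<exists>n. \<forall>i<nat q. x (Suc (n + i)) = x (n + i) + \<beta>")
    case True
    then obtain n where n: "\<And>i. i < nat q \<Longrightarrow> x (Suc (n + i)) = x (n + i) + \<beta>"
      by blast
    have run: "x (n + i) = x n + real i * \<beta>" if "i < nat q" for i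
      using that
    proof (induction i)
      case (Suc i)
      then show ?case
        using n[of i] by (simp add: algebra_simps)
    qed simp
    have "2 * r \<le> r * r"
      using r by (intro mult_right_mono) auto
    also have "\<dots> = r ^ 2"
      by (simp add: power2_eq_square)
    also have "\<dots> \<le> r ^ (2 * L + 4)"
      using r by (intro power_increasing) auto
    finally have "\<bar>r * \<beta> - of_int p\<bar> * (2 * r) \<le> \<bar>r * \<beta> - of_int p\<bar> * r ^ (2 * L + 4)"
      by (intro mult_left_mono) auto
    with approx' have "\<bar>r * \<beta> - of_int p\<bar> * (2 * r) \<le> 1"
      by linarith
    then have "\<bar>r * \<beta> - of_int p\<bar> \<le> 1 / (2 * r)"
      using r by (simp add: field_simps)
    then have sep: "circle_separated (1 / (2 * r)) {n..<n + nat q} x"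
      unfolding r_def using run by (intro run_separated[OF pq(1)]) auto
    have "2 * C = ((2 * C) powr (1 / (1 - s))) powr (1 - s)"
      using C s by (simp add: powr_powr)
    also have "\<dots> < r powr (1 - s)"
      using r s C by (intro powr_less_mono2) auto
    finally have "2 * C * r powr s < r powr (1 - s) * r powr s"
      using r by (intro mult_strict_right_mono) auto
    also have "\<dots> = r"
      using r by (simp flip: powr_add)
    finally have "C * (2 * r powr s) < r" by simp
    moreover have "C * (2 * r) powr s \<le> C * (2 * r powr s)"
    proof -
      have "2 powr s \<le> (2 :: real) powr 1"
        using s by (intro powr_mono) auto
      then show ?thesis
        using C r by (simp add: powr_mult mult_right_mono)
    qed
    ultimately have "C * (2 * r) powr s < r" by linarith
    then have "C * (1 / (1 / (2 * r))) powr s < real (card {n..<n + nat q})"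
      using nq by simp
    with sep r show thesis
      by (intro that[of "1 / (2 * r)" "{n..<n + nat q}"]) auto
  next
    case False
    then have "\<exists>i<nat q. x (Suc (n + i)) \<noteq> x (n + i) + \<beta>" for n
      by blast
    then have "\<forall>k. \<exists>m b. b \<le> k * nat q \<and> x m = x 0 + real k * \<alpha> + real b * \<beta>"
      using frequent_steps_count[of x \<alpha> \<beta> "nat q"] step by blast
    then obtain m b where b: "\<And>k. b k \<le> k * nat q"
      and xm: "\<And>k. x (m k) = x 0 + real k * \<alpha> + real (b k) * \<beta>"
      by metis
    obtain P Q where PQ: "coprime P Q" "0 < Q" "Q \<le> int (nat q ^ L)"
      and dirichlet: "\<bar>of_int Q * (of_int q * \<alpha>) - of_int P\<bar> < 1 / real (nat q ^ L)"
      using Dirichlet_approx_coprime[of "nat q ^ L" "of_int q * \<alpha>"] pq by auto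
    define R where "R = real_of_int Q"
    have R: "R \<ge> 1" "R \<le> r ^ L"
    proof -
      show "R \<ge> 1" using PQ unfolding R_def by linarith
      have "R \<le> real (nat q ^ L)"
        using PQ(3) unfolding R_def by linarith
      then show "R \<le> r ^ L" by (simp add: nq)
    qed
    have dirichlet': "\<bar>R * (r * \<alpha>) - of_int P\<bar> < 1 / r ^ L"
      using dirichlet by (simp add: R_def nq r_def)
    \<comment> \<open>A small \<open>Q\<close> would make \<open>Q q\<close> a denominator that approximates \<open>\<alpha>\<close> too well.\<close>
    have "c / (R * r) ^ t < 1 / r ^ L"
      using diophantine[of "Q * q" P] dirichlet' PQ pq by (simp add: R_def r_def mult.assoc)
    moreover have "R * r \<ge> 1"
      using R r mult_mono[of 1 R 1 r] by simp
    then have "(R * r) ^ t > 0" "r ^ L > 0"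
      using r by (auto intro!: zero_less_power)
    ultimately have "c * r ^ L < (R * r) ^ t"
      by (simp add: divide_less_eq less_divide_eq mult_ac del: power_mult_distrib)
    also have "\<dots> \<le> (R * r) ^ (t + 1)"
      using \<open>R * r \<ge> 1\<close> by (intro power_increasing) auto
    also have "c * r ^ L = (c * r) * (r ^ (k + 1)) ^ (t + 1)"
    proof -
      have "r ^ L = r ^ ((k + 1) * (t + 1)) * r"
        unfolding L_def by (subst power_add) (simp only: power_one_right)
      also have "r ^ ((k + 1) * (t + 1)) = (r ^ (k + 1)) ^ (t + 1)"
        by (rule power_mult)
      finally show ?thesis
        by (simp only: mult_ac)
    qed
    finally have "(c * r) * (r ^ (k + 1)) ^ (t + 1) < (R * r) ^ (t + 1)" .
    moreover have "1 * (r ^ (k + 1)) ^ (t + 1) \<le> (c * r) * (r ^ (k + 1)) ^ (t + 1)"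
      using r c by (intro mult_right_mono) (auto simp: field_simps)
    ultimately have "(r ^ (k + 1)) ^ (t + 1) < (R * r) ^ (t + 1)"
      by linarith
    then have "r ^ (k + 1) < R * r"
      by (rule power_less_imp_less_base) (use R r in auto)
    then have Rk: "r ^ k < R"
      using r by (simp add: mult.commute)
    have le: "1 / r ^ L \<le> 1 / R"
      using R by (intro divide_left_mono) auto
    \<comment> \<open>The accumulated error of the steps \<open>\<beta>\<close>, as \<open>frequent_steps_separated\<close> requires it.\<close>
    have four: "4 * R ^ 2 * r \<le> r ^ (2 * L + 4)"
    proof -
      have "2 * 2 * (r ^ L) ^ 2 * r * 1 \<le> r * r * (r ^ L) ^ 2 * r * r"
        using r by (intro mult_mono) auto
      moreover have "4 * R ^ 2 * r \<le> 4 * (r ^ L) ^ 2 * r"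
        using R r by (intro mult_right_mono mult_left_mono power_mono) auto
      moreover have "r ^ (2 * L + 4) = (r ^ L) ^ 2 * r ^ 4"
        by (simp only: power_add power_mult power2_eq_square power_mult_distrib)
      then have "r * r * (r ^ L) ^ 2 * r * r = r ^ (2 * L + 4)"
        by (simp add: power4_eq_xxxx)
      ultimately show ?thesis by simp
    qed
    have "4 * R ^ 2 * r * \<bar>r * \<beta> - of_int p\<bar> \<le> r ^ (2 * L + 4) * \<bar>r * \<beta> - of_int p\<bar>"
      using four by (intro mult_right_mono) auto
    then have close: "4 * R ^ 2 * r * \<bar>r * \<beta> - of_int p\<bar> \<le> 1"
      using approx' by (simp add: mult.commute)
    define K where "K = {..<nat ((Q + 1) div 2)}"
    have bQ: "int (b k) \<le> Q * q" if "int k < Q" for k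
    proof -
      have "int (b k) \<le> int k * q"
        using of_nat_mono[OF b[of k], where 'a = int] pq by simp
      also have "\<dots> \<le> Q * q"
        using that pq by (intro mult_right_mono) auto
      finally show ?thesis .
    qed
    have sep: "circle_separated (1 / (4 * R * r)) K (\<lambda>k. x (m k))"
      unfolding K_def R_def r_def
      by (rule frequent_steps_separated[OF pq(2) close[unfolded R_def r_def] PQ(2,1) _ xm bQ])
        (use dirichlet' le in \<open>auto simp: R_def r_def\<close>)
    have pos: "1 / (4 * R * r) > 0"
      using R r by simp
    have "2 * C * (4 * r) powr s < R powr (1 - s)"
    proof -
      have "2 * C * (4 * r) powr s \<le> 8 * C * r powr s"
      proof -
        have "4 powr s \<le> (4 :: real) powr 1"
          using s by (intro powr_mono) auto
        then show ?thesis
          using C r by (simp add: powr_mult mult_right_mono)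
      qed
      also have "\<dots> < r * r powr s"
        using r by (intro mult_strict_right_mono) auto
      also have "\<dots> = r powr (s + 1)"
        using r by (simp add: powr_add)
      also have "\<dots> \<le> r powr (real k * (1 - s))"
        using r k by (intro powr_mono) auto
      also have "\<dots> = (r ^ k) powr (1 - s)"
        using r by (simp add: powr_powr flip: powr_realpow)
      also have "\<dots> \<le> R powr (1 - s)"
        using Rk s r by (intro powr_mono2) auto
      finally show ?thesis .
    qed
    then have "2 * C * (4 * r) powr s * R powr s < R powr (1 - s) * R powr s"
      using R by (intro mult_strict_right_mono) auto
    also have "\<dots> = R"
      using R by (simp flip: powr_add)
    finally have "C * (4 * R * r) powr s < R / 2"
      using R r by (simp add: powr_mult mult_ac)
    also have "\<dots> \<le> real (nat ((Q + 1) div 2))"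
      using PQ unfolding R_def by linarith
    also have "\<dots> = real (card (m ` K))"
      using circle_separated_reindex(1)[where x = x and f = m, OF sep pos] by (simp add: card_image K_def)
    finally have "C * (1 / (1 / (4 * R * r))) powr s < real (card (m ` K))"
      by simp
    moreover have "1 / (4 * R * r) \<le> 1"
      using mult_mono[of 1 "4 * R" 1 r] R r by simp
    ultimately show thesis
      using circle_separated_reindex(2)[where x = x and f = m, OF sep pos] pos
      by (intro that[of "1 / (4 * R * r)" "m ` K"]) (auto simp: K_def)
  qed
qed

section \<open>Covering numbers and invariant sets\<close>

text \<open>
  A point of \<open>A\<close> at the largest distance from \<open>B\<close> is the image of a point of \<open>A\<close> under some \<open>\<phi> i\<close>,
  which contracts distances to \<open>B\<close>; so the largest distance is \<open>0\<close>.
\<close>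
lemma invariant_set_subset:
  fixes \<phi> :: "'i \<Rightarrow> 'a :: metric_space \<Rightarrow> 'a"
  assumes scale: "\<And>i x y. i \<in> I \<Longrightarrow> dist (\<phi> i x) (\<phi> i y) = R i * dist x y"
    and ratio: "\<And>i. i \<in> I \<Longrightarrow> R i < 1"
    and A: "compact A" "A \<noteq> {}" "A \<subseteq> (\<Union>i\<in>I. \<phi> i ` A)"
    and B: "compact B" "B \<noteq> {}" "(\<Union>i\<in>I. \<phi> i ` B) \<subseteq> B"
  shows "A \<subseteq> B"
proof -
  have "continuous_on A (\<lambda>x. infdist x B)"
    by (intro continuous_intros)
  then obtain a where a: "a \<in> A" "\<And>x. x \<in> A \<Longrightarrow> infdist x B \<le> infdist a B"
    using continuous_attains_sup[OF A(1,2)] by blast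
  obtain i a' where i: "i \<in> I" "a' \<in> A" "a = \<phi> i a'"
    using a A by blast
  have "continuous_on B (dist a')"
    by (intro continuous_intros)
  then obtain b where b: "b \<in> B" "\<And>y. y \<in> B \<Longrightarrow> dist a' b \<le> dist a' y"
    using continuous_attains_inf[OF B(1,2)] by blast
  have "dist a' b \<le> infdist a' B"
    unfolding infdist_notempty[OF B(2)] using b B(2) by (intro cINF_greatest) auto
  then have b': "infdist a' B = dist a' b"
    using infdist_le[OF b(1), of a'] by linarith
  have "infdist a B \<le> dist a (\<phi> i b)"
    using b i B by (intro infdist_le) auto
  also have "\<dots> = R i * infdist a' B"
    using i b' scale by simp
  finally have 1: "infdist a B \<le> R i * infdist a' B" .
  have "infdist a B \<le> 0"
  proof (rule ccontr)
    assume *: "\<not> infdist a B \<le> 0"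
    show False
    proof (cases "R i \<le> 0")
      case True
      then have "R i * infdist a' B \<le> 0"
        by (simp add: mult_nonpos_nonneg infdist_nonneg)
      with 1 * show False by linarith
    next
      case False
      then have "R i * infdist a' B \<le> R i * infdist a B"
        using a i by (intro mult_left_mono) auto
      also have "\<dots> < 1 * infdist a B"
        using * ratio i by (intro mult_strict_right_mono) auto
      finally show False using 1 by simp
    qed
  qed
  then have "infdist x B = 0" if "x \<in> A" for x
    using a(2)[OF that] infdist_nonneg[of x B] by linarith
  then show ?thesis
    using in_closed_iff_infdist_zero[OF compact_imp_closed[OF B(1)] B(2)] by blast
qed

text \<open>
  Covering numbers of order \<open>\<delta>\<^sup>-\<^sup>s\<close>; this forces the upper box dimension to be at most \<open>s\<close>.
\<close>
definition covering_exponent :: "real \<Rightarrow> 'a :: metric_space set \<Rightarrow> bool" where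
  "covering_exponent s E \<longleftrightarrow>
     (\<exists>C. \<forall>\<delta>. 0 < \<delta> \<and> \<delta> \<le> 1 \<longrightarrow>
        (\<exists>S. finite S \<and> real (card S) \<le> C * (1 / \<delta>) powr s \<and> E \<subseteq> (\<Union>x\<in>S. cball x \<delta>)))"

text \<open>
  The scaled copies of coverings at the scales \<open>\<delta> / \<rho> n\<close> form a covering at the scale \<open>\<delta>\<close>, and the
  assumption on the sum of the \<open>\<rho> n powr s\<close> says exactly that the bound \<open>C \<delta>\<^sup>-\<^sup>s\<close> is inherited.
\<close>
lemma covering_exponent_of_similar_pieces:
  fixes f :: "'n \<Rightarrow> 'a :: metric_space \<Rightarrow> 'a"
  assumes s: "s > 0" and E: "bounded E"
    and N: "finite N" "N \<noteq> {}"
    and ratio: "\<And>n. n \<in> N \<Longrightarrow> 0 < \<rho> n" "\<And>n. n \<in> N \<Longrightarrow> \<rho> n < 1"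
    and scale: "\<And>n x y. n \<in> N \<Longrightarrow> dist (f n x) (f n y) = \<rho> n * dist x y"
    and cover: "E \<subseteq> (\<Union>n\<in>N. f n ` E)"
    and sum: "(\<Sum>n\<in>N. \<rho> n powr s) \<le> 1"
  shows "covering_exponent s E"
proof -
  obtain e B where B: "E \<subseteq> cball e B" "B \<ge> 1"
  proof -
    obtain e B0 where "E \<subseteq> cball e B0"
      using E by (meson bounded_subset_cball)
    moreover have "cball e B0 \<subseteq> cball e (max B0 1)"
      by (intro subset_cball) auto
    ultimately show thesis
      using that[of e "max B0 1"] by auto
  qed
  define m where "m = Min (\<rho> ` N)"
  define M where "M = Max (\<rho> ` N)"
  have m: "0 < m" "m < 1" "\<And>n. n \<in> N \<Longrightarrow> m \<le> \<rho> n"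
    using N ratio by (auto simp: m_def Min_less_iff)
  have M: "0 < M" "M < 1" "\<And>n. n \<in> N \<Longrightarrow> \<rho> n \<le> M"
    using N ratio by (auto simp: M_def Max_gr_iff)
  \<comment> \<open>The scales up to \<open>B / m\<close> are included since the recursion leads from \<open>\<delta> < B\<close> to \<open>\<delta> / \<rho> k\<close>.\<close>
  have main: "\<exists>S. finite S \<and> real (card S) \<le> (B / (m * \<delta>)) powr s \<and> E \<subseteq> (\<Union>x\<in>S. cball x \<delta>)"
    if "0 < \<delta>" "\<delta> \<le> B / m" "B * M ^ n \<le> \<delta>" for \<delta> n
    using that
  proof (induction n arbitrary: \<delta>)
    case (0 \<delta>)
    have "1 \<le> (B / (m * \<delta>)) powr s"
      using 0 m s B by (intro ge_one_powr_ge_zero) (auto simp: field_simps)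
    then show ?case
      using B 0 by (intro exI[of _ "{e}"]) (auto intro: order_trans)
  next
    case (Suc n \<delta>)
    show ?case
    proof (cases "B \<le> \<delta>")
      case True
      have "1 \<le> (B / (m * \<delta>)) powr s"
        using Suc.prems m s B by (intro ge_one_powr_ge_zero) (auto simp: field_simps)
      then show ?thesis
        using B True by (intro exI[of _ "{e}"]) (auto intro: order_trans)
    next
      case False
      have "\<exists>S. finite S \<and> real (card S) \<le> (B / (m * (\<delta> / \<rho> k))) powr s \<and> E \<subseteq> (\<Union>x\<in>S. cball x (\<delta> / \<rho> k))"
        if k: "k \<in> N" for k
      proof (rule Suc.IH)
        show "0 < \<delta> / \<rho> k"
          using Suc.prems ratio k by simp
        show "\<delta> / \<rho> k \<le> B / m"
          using False Suc.prems m k B by (intro frac_le) auto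
        have "B * M ^ n * \<rho> k \<le> B * M ^ n * M"
          using B M k by (intro mult_left_mono) auto
        also have "\<dots> \<le> \<delta>"
          using Suc.prems by (simp add: mult_ac)
        finally show "B * M ^ n \<le> \<delta> / \<rho> k"
          using ratio k by (simp add: field_simps)
      qed
      then obtain S where S: "\<And>k. k \<in> N \<Longrightarrow> finite (S k)"
          "\<And>k. k \<in> N \<Longrightarrow> real (card (S k)) \<le> (B / (m * (\<delta> / \<rho> k))) powr s"
          "\<And>k. k \<in> N \<Longrightarrow> E \<subseteq> (\<Union>x\<in>S k. cball x (\<delta> / \<rho> k))"
        by metis
      define S' where "S' = (\<Union>k\<in>N. f k ` S k)"
      have "finite S'"
        using S N by (auto simp: S'_def)
      moreover have "E \<subseteq> (\<Union>x\<in>S'. cball x \<delta>)"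
      proof
        fix x assume "x \<in> E"
        then obtain k y where k: "k \<in> N" "y \<in> E" "x = f k y"
          using cover by blast
        then obtain z where z: "z \<in> S k" "dist z y \<le> \<delta> / \<rho> k"
          using S(3)[of k] by auto
        then have "dist (f k z) x \<le> \<delta>"
          using k scale ratio by (simp add: field_simps)
        then show "x \<in> (\<Union>x\<in>S'. cball x \<delta>)"
          using k z by (auto simp: S'_def)
      qed
      moreover have "real (card S') \<le> (B / (m * \<delta>)) powr s"
      proof -
        have "card S' \<le> (\<Sum>k\<in>N. card (f k ` S k))"
          unfolding S'_def by (intro card_UN_le N)
        also have "\<dots> \<le> (\<Sum>k\<in>N. card (S k))"
          by (intro sum_mono card_image_le S)
        finally have "real (card S') \<le> (\<Sum>k\<in>N. real (card (S k)))"
          by (simp flip: of_nat_sum)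
        also have "\<dots> \<le> (\<Sum>k\<in>N. (B / (m * \<delta>)) powr s * \<rho> k powr s)"
        proof (intro sum_mono)
          fix k assume k: "k \<in> N"
          have "real (card (S k)) \<le> (B / (m * \<delta>) * \<rho> k) powr s"
            using S(2)[OF k] by (simp add: field_simps)
          also have "\<dots> = (B / (m * \<delta>)) powr s * \<rho> k powr s"
            using k ratio B m Suc.prems by (intro powr_mult) 
          finally show "real (card (S k)) \<le> (B / (m * \<delta>)) powr s * \<rho> k powr s" .
        qed
        also have "\<dots> = (B / (m * \<delta>)) powr s * (\<Sum>k\<in>N. \<rho> k powr s)"
          by (simp add: sum_distrib_left)
        also have "\<dots> \<le> (B / (m * \<delta>)) powr s * 1"
          using sum by (intro mult_left_mono) auto
        finally show ?thesis by simp
      qed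
      ultimately show ?thesis by blast
    qed
  qed
  have "\<exists>S. finite S \<and> real (card S) \<le> (B / m) powr s * (1 / \<delta>) powr s \<and> E \<subseteq> (\<Union>x\<in>S. cball x \<delta>)"
    if \<delta>: "0 < \<delta> \<and> \<delta> \<le> 1" for \<delta>
  proof -
    obtain n where "M ^ n < \<delta> / B"
      using real_arch_pow_inv[of "\<delta> / B" M] M \<delta> B by auto
    then have "B * M ^ n \<le> \<delta>"
      using B by (simp add: field_simps)
    moreover have "1 * m \<le> B"
      using B m by linarith
    then have "\<delta> \<le> B / m"
      using \<delta> m by (simp add: field_simps) (smt (verit) mult_left_le_one_le)
    ultimately have "\<exists>S. finite S \<and> real (card S) \<le> (B / (m * \<delta>)) powr s \<and> E \<subseteq> (\<Union>x\<in>S. cball x \<delta>)"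
      using main[of \<delta> n] \<delta> by blast
    moreover have "(B / (m * \<delta>)) powr s = (B / m) powr s * (1 / \<delta>) powr s"
      using B m \<delta> by (simp flip: powr_mult)
    ultimately show ?thesis by simp
  qed
  then show ?thesis
    unfolding covering_exponent_def by blast
qed

text \<open>
  A distance is determined up to \<open>2 \<delta> / 5\<close> by the two balls of radius \<open>\<delta> / 5\<close> that contain the
  points, so distances that are \<open>\<delta>\<close>-separated belong to different pairs of balls.
\<close>
lemma separated_distances_card:
  fixes E :: "'a :: metric_space set"
  assumes "covering_exponent s E"
  obtains C where "C > 0"
    "\<And>\<delta> G. \<lbrakk>0 < \<delta>; \<delta> \<le> 1; finite G; G \<subseteq> {dist u v |u v. u \<in> E \<and> v \<in> E};
        \<And>g h. g \<in> G \<Longrightarrow> h \<in> G \<Longrightarrow> g \<noteq> h \<Longrightarrow> \<delta> \<le> \<bar>g - h\<bar>\<rbrakk>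
      \<Longrightarrow> real (card G) \<le> C * (1 / \<delta>) powr (2 * s)"
proof -
  obtain C0 where C0: "\<And>\<delta>. 0 < \<delta> \<Longrightarrow> \<delta> \<le> 1 \<Longrightarrow>
      \<exists>S. finite S \<and> real (card S) \<le> C0 * (1 / \<delta>) powr s \<and> E \<subseteq> (\<Union>x\<in>S. cball x \<delta>)"
    using assms unfolding covering_exponent_def by blast
  define C where "C = C0 ^ 2 * 5 powr (2 * s) + 1"
  have "C > 0"
    by (auto simp: C_def intro!: add_nonneg_pos)
  moreover have "real (card G) \<le> C * (1 / \<delta>) powr (2 * s)"
    if \<delta>: "0 < \<delta>" "\<delta> \<le> 1" and G: "finite G" "G \<subseteq> {dist u v |u v. u \<in> E \<and> v \<in> E}"
      and sep: "\<And>g h. g \<in> G \<Longrightarrow> h \<in> G \<Longrightarrow> g \<noteq> h \<Longrightarrow> \<delta> \<le> \<bar>g - h\<bar>" for \<delta> G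
  proof -
    obtain S where S: "finite S" "real (card S) \<le> C0 * (1 / (\<delta> / 5)) powr s" "E \<subseteq> (\<Union>x\<in>S. cball x (\<delta> / 5))"
      using C0[of "\<delta> / 5"] \<delta> by auto
    have "\<exists>z\<in>S \<times> S. \<bar>g - dist (fst z) (snd z)\<bar> \<le> 2 * \<delta> / 5" if "g \<in> G" for g
    proof -
      obtain u v where uv: "g = dist u v" "u \<in> E" "v \<in> E"
        using \<open>g \<in> G\<close> G by blast
      have "u \<in> (\<Union>x\<in>S. cball x (\<delta> / 5))" "v \<in> (\<Union>x\<in>S. cball x (\<delta> / 5))"
        using S(3) uv(2,3) by blast+
      then obtain a b where ab: "a \<in> S" "dist a u \<le> \<delta> / 5" "b \<in> S" "dist b v \<le> \<delta> / 5"
        unfolding UN_iff mem_cball by blast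
      have "\<bar>dist u v - dist a b\<bar> \<le> dist a u + dist b v"
        using dist_triangle[of u v a] dist_triangle[of a v b] dist_triangle[of a b u] dist_triangle[of u b v]
        by (simp add: dist_commute)
      then show ?thesis
        using ab uv by (intro bexI[of _ "(a, b)"]) auto
    qed
    then obtain h where h: "\<And>g. g \<in> G \<Longrightarrow> h g \<in> S \<times> S \<and> \<bar>g - dist (fst (h g)) (snd (h g))\<bar> \<le> 2 * \<delta> / 5"
      by metis
    have "inj_on h G"
    proof (rule inj_onI, rule ccontr)
      fix g g' assume g: "g \<in> G" "g' \<in> G" "h g = h g'" "g \<noteq> g'"
      have "\<bar>g - g'\<bar> \<le> 4 * \<delta> / 5"
        using h[OF g(1)] h[OF g(2)] unfolding g(3) by linarith
      with sep[OF g(1,2,4)] \<delta> show False by linarith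
    qed
    then have "card G \<le> card (S \<times> S)"
      using h S(1) by (intro card_inj_on_le[of h] image_subsetI finite_cartesian_product) blast+
    then have "real (card G) \<le> real (card S) * real (card S)"
      by (simp add: card_cartesian_product flip: of_nat_mult)
    also have "\<dots> \<le> (C0 * (1 / (\<delta> / 5)) powr s) * (C0 * (1 / (\<delta> / 5)) powr s)"
      using S(2) by (intro mult_mono) auto
    also have "\<dots> = C0 ^ 2 * ((5 * (1 / \<delta>)) powr s * (5 * (1 / \<delta>)) powr s)"
      by (simp add: power2_eq_square mult_ac)
    also have "\<dots> = C0 ^ 2 * (5 * (1 / \<delta>)) powr (2 * s)"
      by (simp flip: powr_add)
    also have "\<dots> = C0 ^ 2 * 5 powr (2 * s) * (1 / \<delta>) powr (2 * s)"
      using \<delta> by (subst powr_mult) auto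
    also have "\<dots> \<le> C * (1 / \<delta>) powr (2 * s)"
      by (intro mult_right_mono) (auto simp: C_def)
    finally show ?thesis .
  qed
  ultimately show thesis
    using that by blast
qed

section \<open>Dust-like sets\<close>

text \<open>
  The results on these sets only involve distances and the uniform gap between the pieces. The cylinder of
  a word \<open>w\<close> is \<open>foldr \<phi> w ` E\<close>, and its scale is \<open>prod_list (map R w)\<close>.
\<close>
locale dust_like =
  fixes I :: "'i set" and \<phi> :: "'i \<Rightarrow> 'a :: metric_space \<Rightarrow> 'a" and R :: "'i \<Rightarrow> real"
    and E :: "'a set" and gap :: real
  assumes ratio: "i \<in> I \<Longrightarrow> 0 < R i" "i \<in> I \<Longrightarrow> R i < 1"
    and scale: "i \<in> I \<Longrightarrow> dist (\<phi> i x) (\<phi> i y) = R i * dist x y"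
    and finite_index: "finite I"
    and compact: "compact E" and nonempty: "E \<noteq> {}"
    and invariant: "E = (\<Union>i\<in>I. \<phi> i ` E)"
    and gap_pos: "gap > 0"
    and gap: "\<lbrakk>i \<in> I; j \<in> I; i \<noteq> j; x \<in> E; y \<in> E\<rbrakk> \<Longrightarrow> gap \<le> dist (\<phi> i x) (\<phi> j y)"
begin

lemma same_piece:
  assumes "i \<in> I" "x \<in> E" "z \<in> E" "dist (\<phi> i x) z < gap"
  obtains z' where "z' \<in> E" "z = \<phi> i z'"
proof -
  obtain j z' where "j \<in> I" "z' \<in> E" "z = \<phi> j z'"
    using assms invariant by blast
  with gap[of i j x z'] assms that show thesis
    by force
qed

lemma piece_preimage:
  assumes "x \<in> E"
  obtains i x' where "i \<in> I" "x' \<in> E" "x = \<phi> i x'"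
  using assms invariant by blast

lemma word_ratio:
  assumes "w \<in> lists I"
  shows "0 < prod_list (map R w)" "prod_list (map R w) \<le> 1"
proof -
  have "0 < prod_list (map R w) \<and> prod_list (map R w) \<le> 1"
    using assms
  proof (induction w)
    case (Cons i w)
    then show ?case
      using ratio[of i] by (auto intro: mult_le_one less_imp_le)
  qed auto
  then show "0 < prod_list (map R w)" "prod_list (map R w) \<le> 1"
    by auto
qed

lemma word_scale:
  assumes "w \<in> lists I"
  shows "dist (foldr \<phi> w x) (foldr \<phi> w y) = prod_list (map R w) * dist x y"
  using assms by (induction w) (auto simp: scale)

lemma word_maps_into:
  assumes "w \<in> lists I" "x \<in> E"
  shows "foldr \<phi> w x \<in> E"
  using assms
proof (induction w)
  case (Cons i w)
  then have "\<phi> i (foldr \<phi> w x) \<in> (\<Union>i\<in>I. \<phi> i ` E)" by auto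
  then show ?case using invariant by simp
qed auto

text \<open>
  Cylinders are relatively open in \<open>E\<close>: the gap scales with the cylinder. This permits extracting
  finite coverings by cylinders.
\<close>
lemma cylinder_absorbs_near_points:
  assumes "w \<in> lists I" "x \<in> foldr \<phi> w ` E" "z \<in> E" "dist x z < gap * prod_list (map R w)"
  shows "z \<in> foldr \<phi> w ` E"
  using assms
proof (induction w arbitrary: x z rule: list.induct)
  case (Cons i w)
  then have w: "i \<in> I" "w \<in> lists I"
    by auto
  obtain e where "e \<in> E" "x = \<phi> i (foldr \<phi> w e)"
    using Cons.prems(2) by fastforce
  then obtain x' where x': "x' \<in> foldr \<phi> w ` E" "x = \<phi> i x'" "x' \<in> E" "i \<in> I" "w \<in> lists I"
    using w word_maps_into[of w e] by blast
  have "gap * prod_list (map R (i # w)) \<le> gap * 1"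
    using Cons.prems gap_pos word_ratio(2)[of "i # w"] by (intro mult_left_mono) auto
  with Cons.prems(4) have "dist x z < gap"
    by linarith
  then have "dist (\<phi> i x') z < gap"
    using x'(2) by simp
  then obtain z' where z': "z' \<in> E" "z = \<phi> i z'"
    using same_piece x' Cons.prems by metis
  have "R i * dist x' z' < R i * (gap * prod_list (map R w))"
    using Cons.prems(4) x' z' scale[of i] by (simp add: mult_ac)
  then have "dist x' z' < gap * prod_list (map R w)"
    using ratio[of i] x' by simp
  then have "z' \<in> foldr \<phi> w ` E"
    using Cons.IH x' z' by blast
  then show ?case
    using z' by auto
qed auto

text \<open>
  The cylinder is found by zooming in until the pulled back set no longer has diameter below the
  gap. So up to a constant, cylinders cover \<open>E\<close> as economically as arbitrary sets do.
\<close>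
lemma small_set_in_cylinder:
  assumes "d > 0" "U \<subseteq> E" "\<And>x y. x \<in> U \<Longrightarrow> y \<in> U \<Longrightarrow> dist x y \<le> d"
  obtains w where "w \<in> lists I" "U \<subseteq> foldr \<phi> w ` E" "gap * prod_list (map R w) \<le> d"
proof -
  obtain M where M: "M < 1" "M > 0" "\<And>i. i \<in> I \<Longrightarrow> R i \<le> M"
  proof
    show "Max (insert (1/2) (R ` I)) < 1" "Max (insert (1/2) (R ` I)) > 0"
      using finite_index ratio by (auto simp: Max_gr_iff)
    show "R i \<le> Max (insert (1/2) (R ` I))" if "i \<in> I" for i
      using finite_index that by (intro Max_ge) auto
  qed
  have main: "\<exists>w\<in>lists I. U \<subseteq> foldr \<phi> w ` E \<and> gap * prod_list (map R w) \<le> d"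
    if "U \<noteq> {}" "U \<subseteq> E" "\<And>x y. x \<in> U \<Longrightarrow> y \<in> U \<Longrightarrow> dist x y \<le> d" "gap * M ^ n \<le> d" for U d n
    using that
  proof (induction n arbitrary: U d)
    case (0 U d)
    then show ?case by (intro bexI[of _ "[]"]) auto
  next
    case (Suc n U d)
    show ?case
    proof (cases "gap \<le> d")
      case True
      then show ?thesis using Suc.prems by (intro bexI[of _ "[]"]) auto
    next
      case False
      obtain u where u: "u \<in> U" using Suc.prems by blast
      then obtain i u' where i: "i \<in> I" "u' \<in> E" "u = \<phi> i u'"
        using piece_preimage Suc.prems by blast
      have piece: "\<exists>z'\<in>E. z = \<phi> i z'" if "z \<in> U" for z
        using same_piece[OF i(1,2), of z] Suc.prems(2) Suc.prems(3)[OF u that] that False i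
        by (metis linorder_not_less order_le_less_trans subsetD)
      define U' where "U' = {z \<in> E. \<phi> i z \<in> U}"
      have U: "U = \<phi> i ` U'"
        using piece by (auto simp: U'_def)
      have "\<exists>w\<in>lists I. U' \<subseteq> foldr \<phi> w ` E \<and> gap * prod_list (map R w) \<le> d / R i"
      proof (rule Suc.IH)
        show "U' \<noteq> {}" using U u by auto
        show "U' \<subseteq> E" by (auto simp: U'_def)
        show "dist x y \<le> d / R i" if "x \<in> U'" "y \<in> U'" for x y
          using Suc.prems(3)[of "\<phi> i x" "\<phi> i y"] that ratio[OF i(1)] scale[OF i(1)]
          by (simp add: U'_def field_simps)
        have "gap * M ^ n * R i \<le> gap * M ^ n * M"
          using M i gap_pos by (intro mult_left_mono) auto
        also have "\<dots> \<le> d" using Suc.prems by (simp add: mult_ac)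
        finally show "gap * M ^ n \<le> d / R i"
          using ratio[OF i(1)] by (simp add: field_simps)
      qed
      then obtain w where w: "w \<in> lists I" "U' \<subseteq> foldr \<phi> w ` E" "gap * prod_list (map R w) \<le> d / R i"
        by blast
      then show ?thesis
        using ratio[OF i(1)] i U by (intro bexI[of _ "i # w"]) (auto simp: field_simps)
    qed
  qed
  obtain n where "M ^ n < d / gap"
    using real_arch_pow_inv[of "d / gap" M] M assms gap_pos by auto
  then have n: "gap * M ^ n \<le> d"
    using gap_pos by (simp add: field_simps)
  show thesis
  proof (cases "U = {}")
    case True
    obtain e where "e \<in> E" using nonempty by blast
    then show thesis
      using main[of "{e}" d n] n assms True that by auto
  next
    case False
    then show thesis
      using main[of U d n] n assms that by blast
  qed
qed

text \<open>
  A covering with a tiny \<open>s\<close>-dimensional sum can be replaced by finitely many cylinders with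
  \<open>\<Sum> \<rho>\<^sup>s < 1\<close>. These cylinders are again similar copies of \<open>E\<close>, so a single efficient
  covering is iterated to all scales.
\<close>
lemma null_measure_imp_covering_exponent:
  assumes s: "s > 0" and null: "hausdorff_measure s E = 0"
  shows "covering_exponent s E"
proof -
  define \<epsilon> where "\<epsilon> = gap powr s / 2"
  have \<epsilon>: "\<epsilon> > 0" using gap_pos by (simp add: \<epsilon>_def)
  have "hausdorff_premeasure s 1 E \<le> hausdorff_measure s E"
    unfolding hausdorff_measure_def by (intro SUP_upper) auto
  then have "hausdorff_premeasure s 1 E < ennreal \<epsilon>"
    using null \<epsilon> by simp
  then obtain U where U: "E \<subseteq> (\<Union>n. U n)" "\<And>n. bounded (U n)"
      "(\<Sum>n. ennreal (diameter (U n) powr s)) < ennreal \<epsilon>"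
    unfolding hausdorff_premeasure_def INF_less_iff by blast
  \<comment> \<open>Covering sets of diameter \<open>0\<close> need cylinders of positive size; the sizes are chosen
    such that their \<open>s\<close>-th powers add up to at most \<open>\<epsilon> / 2\<close>.\<close>
  define d where "d n = (if diameter (U n) > 0 then diameter (U n)
      else (\<epsilon> * (1/2) ^ (n + 2)) powr (1 / s))" for n
  have d: "d n > 0" "diameter (U n) \<le> d n"
      "d n powr s \<le> diameter (U n) powr s + \<epsilon> * (1/2) ^ (n + 2)" for n
    using \<epsilon> s diameter_ge_0[OF U(2)[of n]] by (auto simp: d_def powr_powr)
  have "\<exists>w. w \<in> lists I \<and> U n \<inter> E \<subseteq> foldr \<phi> w ` E \<and> gap * prod_list (map R w) \<le> d n" for n
  proof (rule small_set_in_cylinder[of "d n" "U n \<inter> E"])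
    fix x y assume "x \<in> U n \<inter> E" "y \<in> U n \<inter> E"
    then show "dist x y \<le> d n"
      using diameter_bounded_bound[OF U(2)[of n], of x y] d(2)[of n] by auto
  qed (use d in auto)
  then obtain w where w: "\<And>n. w n \<in> lists I" "\<And>n. U n \<inter> E \<subseteq> foldr \<phi> (w n) ` E"
      "\<And>n. gap * prod_list (map R (w n)) \<le> d n"
    by metis
  define \<rho> where "\<rho> n = prod_list (map R (w n))" for n
  define V where "V n = (\<Union>x\<in>foldr \<phi> (w n) ` E. ball x (gap * \<rho> n))" for n
  have \<rho>_pos: "\<rho> n > 0" for n
    using word_ratio w by (simp add: \<rho>_def)
  have "E \<subseteq> (\<Union>n\<in>UNIV. V n)"
  proof
    fix x assume "x \<in> E"
    then obtain n where "x \<in> U n \<inter> E" using U by blast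
    then have "x \<in> foldr \<phi> (w n) ` E" "x \<in> ball x (gap * \<rho> n)"
      using w(2)[of n] gap_pos \<rho>_pos[of n] by auto
    then have "x \<in> V n"
      unfolding V_def by blast
    then show "x \<in> (\<Union>n\<in>UNIV. V n)" by blast
  qed
  moreover have "open (V n)" for n
    unfolding V_def by (intro open_UN ballI open_ball)
  ultimately obtain N where N: "finite N" "E \<subseteq> (\<Union>n\<in>N. V n)"
    using compactE_image[OF compact, of UNIV V] by metis
  have cover: "E \<subseteq> (\<Union>n\<in>N. foldr \<phi> (w n) ` E)"
  proof
    fix x assume x: "x \<in> E"
    then obtain n y where n: "n \<in> N" "y \<in> foldr \<phi> (w n) ` E" "dist y x < gap * \<rho> n"
      using N by (force simp: V_def)
    then have "x \<in> foldr \<phi> (w n) ` E"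
      using cylinder_absorbs_near_points[OF w(1) n(2) x] by (simp add: \<rho>_def)
    with n show "x \<in> (\<Union>n\<in>N. foldr \<phi> (w n) ` E)" by blast
  qed
  have "gap powr s * (\<Sum>n\<in>N. \<rho> n powr s) = (\<Sum>n\<in>N. (gap * \<rho> n) powr s)"
    using gap_pos \<rho>_pos by (simp add: sum_distrib_left powr_mult less_imp_le)
  also have "\<dots> \<le> (\<Sum>n\<in>N. d n powr s)"
    using w(3) gap_pos \<rho>_pos s by (intro sum_mono powr_mono2) (auto simp: \<rho>_def less_imp_le)
  also have "\<dots> \<le> (\<Sum>n\<in>N. diameter (U n) powr s + \<epsilon> * (1/2) ^ (n + 2))"
    by (intro sum_mono d)
  also have "\<dots> = (\<Sum>n\<in>N. diameter (U n) powr s) + \<epsilon> / 4 * (\<Sum>n\<in>N. (1/2) ^ n)"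
    by (simp add: sum.distrib sum_distrib_left)
  also have "(\<Sum>n\<in>N. diameter (U n) powr s) \<le> \<epsilon>"
  proof -
    have "ennreal (\<Sum>n\<in>N. diameter (U n) powr s) = (\<Sum>n\<in>N. ennreal (diameter (U n) powr s))"
      by (simp add: sum_ennreal)
    also have "\<dots> \<le> (\<Sum>n. ennreal (diameter (U n) powr s))"
      using N(1) by (intro sum_le_suminf) auto
    also have "\<dots> \<le> ennreal \<epsilon>"
      using U(3) by simp
    finally show ?thesis
      using \<epsilon> by (simp add: ennreal_le_iff)
  qed
  also have "(\<Sum>n\<in>N. (1/2 :: real) ^ n) \<le> 2"
    using sum_le_suminf[of "\<lambda>n. (1/2 :: real) ^ n" N] N(1) suminf_geometric[of "1/2 :: real"]
    by (simp add: summable_geometric)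
  finally have "gap powr s * (\<Sum>n\<in>N. \<rho> n powr s) \<le> \<epsilon> + \<epsilon> / 4 * 2"
    using \<epsilon> by (simp add: mult_left_mono)
  also have "\<dots> < gap powr s * 1"
    using \<epsilon> gap_pos by (simp add: \<epsilon>_def)
  finally have sum: "(\<Sum>n\<in>N. \<rho> n powr s) < 1"
    using gap_pos by simp
  have "\<rho> n < 1" if "n \<in> N" for n
  proof -
    have "\<rho> n powr s \<le> (\<Sum>n\<in>N. \<rho> n powr s)"
      using N that by (intro member_le_sum) auto
    with sum have "\<rho> n powr s < 1" by linarith
    then show ?thesis
      using ge_one_powr_ge_zero[of "\<rho> n" s] s by linarith
  qed
  then show ?thesis
    using s N nonempty cover sum \<rho>_pos compact_imp_bounded[OF compact] word_scale w
    by (intro covering_exponent_of_similar_pieces[of s E N \<rho> "\<lambda>n. foldr \<phi> (w n)"])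
      (auto simp: \<rho>_def)
qed

text \<open>
  The inverse branches of the maps define an expanding map \<open>T\<close> on \<open>E\<close>. As long as the images of \<open>y\<close>
  and \<open>z\<close> are closer than the gap, they lie in the same piece and \<open>T\<close> magnifies their distance by the
  reciprocal of the ratio of that piece.
\<close>
lemma rescaled_distances:
  assumes "y \<in> E"
  obtains code :: "nat \<Rightarrow> 'i" where "\<And>m. code m \<in> I"
    "\<And>z m. z \<in> E \<Longrightarrow> dist y z < gap * (\<Prod>l<m. R (code l)) \<Longrightarrow>
       \<exists>u\<in>E. \<exists>v\<in>E. dist u v = dist y z / (\<Prod>l<m. R (code l))"
proof -
  have "\<exists>i x'. i \<in> I \<and> x' \<in> E \<and> x = \<phi> i x'" if "x \<in> E" for x
    using piece_preimage[OF that] by metis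
  then obtain k T where kT: "\<And>x. x \<in> E \<Longrightarrow> k x \<in> I" "\<And>x. x \<in> E \<Longrightarrow> T x \<in> E"
      "\<And>x. x \<in> E \<Longrightarrow> x = \<phi> (k x) (T x)"
    by metis
  have orbit: "(T ^^ m) y \<in> E" for m
    using assms kT by (induction m) auto
  define code where "code m = k ((T ^^ m) y)" for m
  define P where "P m = (\<Prod>l<m. R (code l))" for m
  have code: "code m \<in> I" for m
    using kT orbit by (simp add: code_def)
  have P: "P m > 0" for m
    unfolding P_def using code ratio by (intro prod_pos) auto
  have main: "\<exists>v\<in>E. dist ((T ^^ m) y) v = dist y z / P m" if "z \<in> E" "dist y z < gap * P m" for z m
    using that(2)
  proof (induction m)
    case 0
    then show ?case using that by (auto simp: P_def)
  next
    case (Suc m)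
    define i where "i = code m"
    have i: "i \<in> I" "0 < R i" "R i < 1"
      using code ratio by (auto simp: i_def)
    have P_Suc: "P (Suc m) = P m * R i"
      by (simp add: P_def i_def)
    have lt: "dist y z / P m < gap * R i"
      using Suc.prems P[of m] by (simp add: P_Suc field_simps)
    also have "\<dots> \<le> gap * 1"
      using i gap_pos by (intro mult_left_mono) auto
    finally have lt': "dist y z / P m < gap" by simp
    then have "dist y z < gap * P m"
      using P[of m] by (simp add: field_simps)
    then obtain v where v: "v \<in> E" "dist ((T ^^ m) y) v = dist y z / P m"
      using Suc.IH by blast
    have step: "(T ^^ m) y = \<phi> i ((T ^^ Suc m) y)"
      using kT(3)[OF orbit[of m]] by (simp add: i_def code_def)
    obtain v' where v': "v' \<in> E" "v = \<phi> i v'"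
      using same_piece[OF i(1) orbit[of "Suc m"] v(1)] lt' v(2) step by metis
    have "R i * dist ((T ^^ Suc m) y) v' = dist y z / P m"
      using scale[OF i(1)] v(2) v'(2) step by metis
    then have "dist ((T ^^ Suc m) y) v' = dist y z / P (Suc m)"
      using i P[of m] by (simp add: P_Suc field_simps)
    with v' show ?case by blast
  qed
  show thesis
    using that[of code] code main orbit unfolding P_def by blast
qed

end

section \<open>Geometric sequences in dust-like sets with two ratios\<close>
lemma abs_ln_diff_le:
  fixes a b l :: real
  assumes "0 < l" "l \<le> a" "l \<le> b"
  shows "\<bar>ln a - ln b\<bar> \<le> \<bar>a - b\<bar> / l"
proof -
  have *: "ln u - ln v \<le> \<bar>u - v\<bar> / l" if "l \<le> u" "l \<le> v" for u v
  proof -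
    have "ln u - ln v \<le> (u - v) / v"
      using that assms by (intro ln_diff_le) auto
    also have "\<dots> \<le> \<bar>u - v\<bar> / v"
      using that assms by (intro divide_right_mono) auto
    also have "\<dots> \<le> \<bar>u - v\<bar> / l"
      using that assms by (intro divide_left_mono) auto
    finally show ?thesis .
  qed
  from *[of a b] *[of b a] assms show ?thesis
    by (auto simp: abs_minus_commute)
qed

context dust_like
begin

text \<open>
  The rescaled distances are few because they are distances of \<open>E\<close>, and many because modulo \<open>1\<close>
  their logarithms follow a path with the two steps \<open>- (ln r\<^sub>1 / ln \<rho>)\<close> and \<open>- (ln r\<^sub>2 / ln \<rho>)\<close>.
\<close>
lemma no_geometric_distances:
  assumes y: "y \<in> E" and z: "\<And>n. z n \<in> E" "\<And>n. dist y (z n) = \<rho> ^ n * d" and d: "d > 0"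
    and \<rho>: "0 < \<rho>" "\<rho> < 1"
    and two_ratios: "\<And>i. i \<in> I \<Longrightarrow> R i = r\<^sub>1 \<or> R i = r\<^sub>2"
    and r: "0 < r\<^sub>1" "r\<^sub>1 < 1" "0 < r\<^sub>2" "r\<^sub>2 < 1"
    and \<alpha>: "- (ln r\<^sub>1 / ln \<rho>) \<notin> \<rat>" "\<not> liouville (- (ln r\<^sub>1 / ln \<rho>))"
    and \<beta>: "liouville (- (ln r\<^sub>2 / ln \<rho>))"
    and s: "s > 0" "2 * s < 1" "covering_exponent s E"
  shows False
proof -
  obtain code :: "nat \<Rightarrow> 'i" where code: "\<And>m. code m \<in> I"
    and rescaled: "\<And>z m. z \<in> E \<Longrightarrow> dist y z < gap * (\<Prod>l<m. R (code l)) \<Longrightarrow>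
       \<exists>u\<in>E. \<exists>v\<in>E. dist u v = dist y z / (\<Prod>l<m. R (code l))"
    using rescaled_distances[OF y] by metis
  define P where "P m = (\<Prod>l<m. R (code l))" for m
  have P: "P m > 0" for m
    unfolding P_def using code ratio by (intro prod_pos) auto
  have P_Suc: "P (Suc m) = P m * R (code m)" for m
    by (simp add: P_def)
  have P_le: "P m \<le> max r\<^sub>1 r\<^sub>2 ^ m" for m
  proof (induction m)
    case (Suc m)
    have "R (code m) \<le> max r\<^sub>1 r\<^sub>2"
      using two_ratios[OF code[of m]] by auto
    then have "P m * R (code m) \<le> max r\<^sub>1 r\<^sub>2 ^ m * max r\<^sub>1 r\<^sub>2"
      using Suc ratio[OF code[of m]] r by (intro mult_mono) auto
    then show ?case unfolding P_Suc power_Suc2 .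
  qed (simp add: P_def)
  \<comment> \<open>From the level \<open>m0\<close> on, the first term \<open>d\<close> of the sequence exceeds the gap of the cylinder, so
    some term of the sequence falls just below it.\<close>
  obtain m0 where m0: "max r\<^sub>1 r\<^sub>2 ^ m0 < d / gap"
    using real_arch_pow_inv[of "d / gap" "max r\<^sub>1 r\<^sub>2"] r d gap_pos by auto
  have large: "gap * P (m0 + m) \<le> d" for m
  proof -
    have "max r\<^sub>1 r\<^sub>2 ^ (m0 + m) \<le> max r\<^sub>1 r\<^sub>2 ^ m0"
      using r by (intro power_decreasing) auto
    with P_le[of "m0 + m"] m0 have "P (m0 + m) < d / gap"
      by linarith
    then show ?thesis
      using gap_pos by (simp add: field_simps)
  qed
  have "\<exists>n. \<rho> * gap \<le> \<rho> ^ n * d / P (m0 + m) \<and> \<rho> ^ n * d / P (m0 + m) < gap" for m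
  proof -
    define n where "n = (LEAST n. \<rho> ^ n * d < gap * P (m0 + m))"
    obtain n' where "\<rho> ^ n' < gap * P (m0 + m) / d"
      using real_arch_pow_inv[of "gap * P (m0 + m) / d" \<rho>] P gap_pos \<rho> d by auto
    then have "\<rho> ^ n' * d < gap * P (m0 + m)"
      using d by (simp add: field_simps)
    then have n: "\<rho> ^ n * d < gap * P (m0 + m)"
      unfolding n_def by (rule LeastI)
    then have "n \<noteq> 0"
      using large[of m] by (intro notI) auto
    then obtain k where k: "n = Suc k"
      using not0_implies_Suc by blast
    then have "\<not> \<rho> ^ k * d < gap * P (m0 + m)"
      using not_less_Least[of k "\<lambda>n. \<rho> ^ n * d < gap * P (m0 + m)"] unfolding n_def by simp
    then have "\<rho> * (gap * P (m0 + m)) \<le> \<rho> * (\<rho> ^ k * d)"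
      using \<rho> by (intro mult_left_mono) auto
    with n P[of "m0 + m"] k show ?thesis
      by (intro exI[of _ n]) (simp add: field_simps)
  qed
  then obtain n where n: "\<And>m. \<rho> * gap \<le> \<rho> ^ n m * d / P (m0 + m)" "\<And>m. \<rho> ^ n m * d / P (m0 + m) < gap"
    by metis
  define g where "g m = \<rho> ^ n m * d / P (m0 + m)" for m
  have g_dist: "g m \<in> {dist u v |u v. u \<in> E \<and> v \<in> E}" for m
  proof -
    have "dist y (z (n m)) < gap * P (m0 + m)"
      using n(2)[of m] P[of "m0 + m"] by (simp add: z(2) field_simps)
    then obtain u v where "u \<in> E" "v \<in> E" "dist u v = dist y (z (n m)) / P (m0 + m)"
      using rescaled[OF z(1)] unfolding P_def by blast
    then show ?thesis
      by (auto simp: g_def z(2)) metis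
  qed
  \<comment> \<open>The path; the exponent \<open>n m\<close> is an integer and disappears modulo \<open>1\<close>.\<close>
  define x where "x m = - (ln (P (m0 + m)) / ln \<rho>)" for m
  have ln_\<rho>: "ln \<rho> < 0"
    using \<rho> by simp
  have step: "x (Suc m) = x m + - (ln r\<^sub>1 / ln \<rho>) \<or> x (Suc m) = x m + - (ln r\<^sub>2 / ln \<rho>)" for m
  proof -
    have "x (Suc m) = x m + - (ln (R (code (m0 + m))) / ln \<rho>)"
      using P[of "m0 + m"] ratio[OF code[of "m0 + m"]]
      by (simp add: x_def P_Suc ln_mult add_divide_distrib)
    then show ?thesis
      using two_ratios[OF code[of "m0 + m"]] by auto
  qed
  have ln_g: "ln (g m) = ln \<rho> * (real (n m) + x m) + ln d" for m
    using P[of "m0 + m"] \<rho> d ln_\<rho>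
    by (simp add: g_def x_def ln_div ln_mult ln_realpow field_simps)
  \<comment> \<open>Lipschitz constant for the passage from the circle back to distances, cut off at \<open>1\<close> to keep
    scales in the range of \<open>separated_distances_card\<close>.\<close>
  define \<kappa> where "\<kappa> = min 1 (\<rho> * gap * \<bar>ln \<rho>\<bar>)"
  have "0 < \<rho> * gap * \<bar>ln \<rho>\<bar>"
    using \<rho> gap_pos ln_\<rho> by (intro mult_pos_pos) auto
  then have \<kappa>: "0 < \<kappa>" "\<kappa> \<le> 1"
    by (auto simp: \<kappa>_def)
  obtain C where C: "C > 0"
    and few: "\<And>\<delta> G. \<lbrakk>0 < \<delta>; \<delta> \<le> 1; finite G; G \<subseteq> {dist u v |u v. u \<in> E \<and> v \<in> E};
        \<And>g h. g \<in> G \<Longrightarrow> h \<in> G \<Longrightarrow> g \<noteq> h \<Longrightarrow> \<delta> \<le> \<bar>g - h\<bar>\<rbrakk>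
      \<Longrightarrow> real (card G) \<le> C * (1 / \<delta>) powr (2 * s)"
    using separated_distances_card[OF s(3)] by blast
  obtain \<delta> M where \<delta>: "0 < \<delta>" "\<delta> \<le> 1" and M: "finite M" "circle_separated \<delta> M x"
    and many: "C * (1 / \<kappa>) powr (2 * s) * (1 / \<delta>) powr (2 * s) < real (card M)"
    using two_step_path_separated_points[where x = x and s = "2 * s" and C = "C * (1 / \<kappa>) powr (2 * s)",
        OF \<alpha> \<beta> step] s(1,2) C \<kappa>(1)
    by auto
  have sep: "\<kappa> * \<delta> \<le> \<bar>g m - g m'\<bar>" if m: "m \<in> M" "m' \<in> M" "m \<noteq> m'" for m m'
  proof -
    have "\<delta> \<le> \<bar>x m - x m' - of_int (int (n m') - int (n m))\<bar>"
      using M(2) m unfolding circle_separated_def by blast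
    then have "\<bar>ln \<rho>\<bar> * \<delta> \<le> \<bar>ln \<rho>\<bar> * \<bar>x m - x m' - of_int (int (n m') - int (n m))\<bar>"
      by (intro mult_left_mono) auto
    also have "\<dots> = \<bar>ln (g m) - ln (g m')\<bar>"
      unfolding ln_g abs_mult[symmetric] by (simp add: algebra_simps)
    also have "\<dots> \<le> \<bar>g m - g m'\<bar> / (\<rho> * gap)"
      using n(1) \<rho> gap_pos by (intro abs_ln_diff_le) (auto simp: g_def)
    finally have "\<rho> * gap * \<bar>ln \<rho>\<bar> * \<delta> \<le> \<bar>g m - g m'\<bar>"
      using \<rho> gap_pos by (simp add: field_simps)
    moreover have "\<kappa> * \<delta> \<le> \<rho> * gap * \<bar>ln \<rho>\<bar> * \<delta>"
      using \<delta> by (intro mult_right_mono) (auto simp: \<kappa>_def)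
    ultimately show ?thesis by linarith
  qed
  have \<kappa>\<delta>: "0 < \<kappa> * \<delta>" "\<kappa> * \<delta> \<le> 1"
    using \<kappa> \<delta> by (auto intro: mult_le_one)
  have "inj_on g M"
  proof (rule inj_onI, rule ccontr)
    fix m m' assume "m \<in> M" "m' \<in> M" "g m = g m'" "m \<noteq> m'"
    with sep[of m m'] \<kappa>\<delta> show False by simp
  qed
  then have "real (card M) = real (card (g ` M))"
    by (simp add: card_image)
  also have "\<dots> \<le> C * (1 / (\<kappa> * \<delta>)) powr (2 * s)"
  proof (rule few[OF \<kappa>\<delta>])
    show "finite (g ` M)" using M by simp
    show "g ` M \<subseteq> {dist u v |u v. u \<in> E \<and> v \<in> E}" using g_dist by blast
    show "\<kappa> * \<delta> \<le> \<bar>a - b\<bar>" if "a \<in> g ` M" "b \<in> g ` M" "a \<noteq> b" for a b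
      using that sep by blast
  qed
  also have "\<dots> = C * (1 / \<kappa>) powr (2 * s) * (1 / \<delta>) powr (2 * s)"
    using \<kappa> \<delta> by (simp flip: powr_mult)
  finally show False
    using many by linarith
qed

end

section \<open>Affine embeddings of self-similar sets\<close>
lemma similarity_scales_dist:
  assumes "similarity_with_ratio r f"
  shows "0 < r" "r < 1" "dist (f x) (f y) = r * dist x y"
proof -
  obtain U t where U: "orthogonal_matrix U" "f = (\<lambda>x. r *\<^sub>R (U *v x) + t)"
    using assms by (auto simp: similarity_with_ratio_def)
  show r: "0 < r" "r < 1"
    using assms by (auto simp: similarity_with_ratio_def)
  have "orthogonal_transformation ((*v) U)"
    using U(1) by (simp add: orthogonal_transformation_matrix)
  then have "norm (U *v (x - y)) = norm (x - y)"
    by (rule orthogonal_transformation_norm)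
  moreover have "f x - f y = r *\<^sub>R (U *v (x - y))"
    by (simp add: U(2) matrix_vector_mult_diff_distrib scaleR_diff_right)
  ultimately show "dist (f x) (f y) = r * dist x y"
    using r by (simp add: dist_norm)
qed

lemma self_similar_set_unique:
  fixes \<phi> :: "'i \<Rightarrow> real ^ 'd \<Rightarrow> real ^ 'd"
  assumes "ifs I \<phi>" "self_similar_set I \<phi> A" "self_similar_set I \<phi> B"
  shows "A = B"
proof -
  obtain R where R: "\<And>i. i \<in> I \<Longrightarrow> similarity_with_ratio (R i) (\<phi> i)"
    using assms(1) unfolding ifs_def by metis
  note scale = similarity_scales_dist[OF R]
  have "X \<subseteq> Y" if "self_similar_set I \<phi> X" "self_similar_set I \<phi> Y" for X Y
  proof (rule invariant_set_subset[of I \<phi> R])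
    show "X \<subseteq> (\<Union>i\<in>I. \<phi> i ` X)" "(\<Union>i\<in>I. \<phi> i ` Y) \<subseteq> Y"
      using that unfolding self_similar_set_def by blast+
  qed (use that in \<open>simp_all only: scale self_similar_set_def not_False_eq_True\<close>)
  with assms show ?thesis by blast
qed

lemma dust_like_of_strong_separation:
  fixes \<phi> :: "'i \<Rightarrow> real ^ 'd \<Rightarrow> real ^ 'd"
  assumes ifs: "ifs I \<phi>" and E: "self_similar_set I \<phi> E" and ssc: "strong_separation I \<phi>"
    and R: "\<And>i. i \<in> I \<Longrightarrow> similarity_with_ratio (R i) (\<phi> i)"
  obtains gap where "dust_like I \<phi> R E gap"
proof -
  note scale = similarity_scales_dist[OF R]
  have E': "compact E" "E \<noteq> {}" and invariant: "E = (\<Union>i\<in>I. \<phi> i ` E)" and fin: "finite I"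
    using E ifs unfolding self_similar_set_def ifs_def by blast+
  have disj: "\<phi> i ` E \<inter> \<phi> j ` E = {}" if "i \<in> I" "j \<in> I" "i \<noteq> j" for i j
    using ssc self_similar_set_unique[OF ifs E] that unfolding strong_separation_def by metis
  have "continuous_on E (\<phi> i)" if i: "i \<in> I" for i
  proof -
    obtain r U t where "\<phi> i = (\<lambda>x. r *\<^sub>R (U *v x) + t)"
      using R[OF i] by (auto simp: similarity_with_ratio_def)
    then show ?thesis by (auto intro!: continuous_intros)
  qed
  then have comp: "compact (\<phi> i ` E)" if "i \<in> I" for i
    using that E' compact_continuous_image by blast
  \<comment> \<open>The element \<open>1\<close> provides a minimum when there is only one piece.\<close>
  define D where "D = insert 1 ((\<lambda>(i, j). setdist (\<phi> i ` E) (\<phi> j ` E)) ` {(i, j) \<in> I \<times> I. i \<noteq> j})"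
  have D: "finite D"
    unfolding D_def using fin by (auto intro: finite_subset[of _ "I \<times> I"])
  have "dust_like I \<phi> R E (Min D)"
  proof
    have "setdist (\<phi> i ` E) (\<phi> j ` E) > 0" if "i \<in> I" "j \<in> I" "i \<noteq> j" for i j
      using setdist_gt_0_compact_closed[OF comp[OF that(1)] compact_imp_closed[OF comp[OF that(2)]]]
        disj[OF that] E'(2) by simp
    then have "a > 0" if "a \<in> D" for a
      using that by (auto simp: D_def)
    then show "Min D > 0"
      using D by (simp add: D_def)
    show "Min D \<le> dist (\<phi> i x) (\<phi> j y)" if "i \<in> I" "j \<in> I" "i \<noteq> j" "x \<in> E" "y \<in> E" for i j x y
    proof -
      have "Min D \<le> setdist (\<phi> i ` E) (\<phi> j ` E)"
        using that D by (intro Min_le) (auto simp: D_def)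
      also have "\<dots> \<le> dist (\<phi> i x) (\<phi> j y)"
        using that by (intro setdist_le_dist) auto
      finally show ?thesis .
    qed
    show "E = (\<Union>i\<in>I. \<phi> i ` E)" by (fact invariant)
  qed (use scale E' fin in auto)
  then show thesis by (rule that)
qed

theorem corollary4p3:
  fixes \<phi> :: "'i \<Rightarrow> real ^ 'd \<Rightarrow> real ^ 'd" and I I\<^sub>1 I\<^sub>2 :: "'i set"
    and \<psi> :: "'j \<Rightarrow> real ^ 'd \<Rightarrow> real ^ 'd" and J :: "'j set"
    and E F :: "(real ^ 'd) set"
    and r\<^sub>1 r\<^sub>2 :: real and r' :: "'j \<Rightarrow> real" and j\<^sub>0 :: 'j and t\<^sub>0 :: "real ^ 'd"
  assumes "ifs I \<phi>" and "self_similar_set I \<phi> E"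
    and "ifs J \<psi>" and "self_similar_set J \<psi> F"
    and "\<not> (\<exists>x. F = {x})"
    and "\<forall>j\<in>J. similarity_with_ratio (r' j) (\<psi> j)"
    and "strong_separation I \<phi>"
    and "0 < r\<^sub>1" "r\<^sub>1 < 1" "0 < r\<^sub>2" "r\<^sub>2 < 1"
    and "I\<^sub>1 \<subseteq> I" "I\<^sub>2 \<subseteq> I" "I = I\<^sub>1 \<union> I\<^sub>2"
    and "\<forall>i\<in>I\<^sub>1. similarity_with_ratio r\<^sub>1 (\<phi> i)"
    and "\<forall>i\<in>I\<^sub>2. similarity_with_ratio r\<^sub>2 (\<phi> i)"
    and "j\<^sub>0 \<in> J"
    and "\<psi> j\<^sub>0 = (\<lambda>x. r' j\<^sub>0 *\<^sub>R (mat 1 *v x) + t\<^sub>0)"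
    and "- (ln r\<^sub>1 / ln (r' j\<^sub>0)) \<notin> \<rat>" and "\<not> liouville (- (ln r\<^sub>1 / ln (r' j\<^sub>0)))"
    and "liouville (- (ln r\<^sub>2 / ln (r' j\<^sub>0)))"
    and "hausdorff_dim E < 1 / 2"
  shows "\<not> affinely_embeds F E"
proof
  assume "affinely_embeds F E"
  then obtain A :: "real ^ 'd ^ 'd" and a where A: "invertible A" "\<And>x. x \<in> F \<Longrightarrow> A *v x + a \<in> E"
    unfolding affinely_embeds_def by blast
  \<comment> \<open>An index in both sets may be given either ratio: the two coincide there.\<close>
  define R where "R i = (if i \<in> I\<^sub>1 then r\<^sub>1 else r\<^sub>2)" for i
  have R: "similarity_with_ratio (R i) (\<phi> i)" if "i \<in> I" for i
    using that assms by (auto simp: R_def)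
  obtain gap where "dust_like I \<phi> R E gap"
    using dust_like_of_strong_separation[OF assms(1,2,7) R] by blast
  then interpret dust_like I \<phi> R E gap .
  define \<rho> where "\<rho> = r' j\<^sub>0"
  define h where "h = \<psi> j\<^sub>0"
  have h: "h x = \<rho> *\<^sub>R x + t\<^sub>0" for x
    using assms by (simp add: h_def \<rho>_def)
  have \<rho>: "0 < \<rho>" "\<rho> < 1"
    using assms similarity_scales_dist(1,2) unfolding \<rho>_def by blast+
  have F: "F \<noteq> {}" "compact F"
    using \<open>self_similar_set J \<psi> F\<close> unfolding self_similar_set_def by blast+
  have hF: "h x \<in> F" if "x \<in> F" for x
    using that \<open>j\<^sub>0 \<in> J\<close> \<open>self_similar_set J \<psi> F\<close> unfolding h_def self_similar_set_def by blast
  obtain p where p: "p \<in> F" "h p = p"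
  proof -
    have "\<exists>!x. x \<in> F \<and> h x = x"
      using F hF \<rho> by (intro Banach_fix[where c = \<rho>])
        (auto simp: h compact_imp_complete dist_norm simp flip: scaleR_diff_right)
    then show thesis using that by blast
  qed
  obtain q where q: "q \<in> F" "q \<noteq> p"
    using p assms(5) by blast
  have points: "p + \<rho> ^ n *\<^sub>R (q - p) \<in> F" for n
  proof (induction n)
    case 0
    then show ?case using q by simp
  next
    case (Suc n)
    have "h (p + \<rho> ^ n *\<^sub>R (q - p)) = h p + \<rho> ^ Suc n *\<^sub>R (q - p)"
      by (simp add: h scaleR_add_right)
    with hF[OF Suc] p show ?case by simp
  qed
  have "A *v (q - p) \<noteq> 0"
  proof
    assume "A *v (q - p) = 0"
    moreover have "inj ((*v) A)"
      using A(1) by (simp add: inj_matrix_vector_mult)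
    ultimately have "q - p = 0"
      by (metis injD matrix_vector_mult_0_right)
    with q show False by simp
  qed
  obtain s where s: "s > 0" "hausdorff_measure s E = 0" "ereal s < 1 / 2"
    using \<open>hausdorff_dim E < 1 / 2\<close> unfolding hausdorff_dim_def INF_less_iff by auto
  have "2 * s < 1"
  proof -
    have "(1 :: ereal) / 2 = ereal (1 / 2)"
      using ereal_divide[of 1 2] by (simp flip: one_ereal_def)
    with s(3) show ?thesis by simp
  qed
  show False
  proof (rule no_geometric_distances[where y = "A *v p + a" and \<rho> = \<rho> and s = s
        and z = "\<lambda>n. A *v (p + \<rho> ^ n *\<^sub>R (q - p)) + a" and d = "norm (A *v (q - p))"])
    show "dist (A *v p + a) (A *v (p + \<rho> ^ n *\<^sub>R (q - p)) + a) = \<rho> ^ n * norm (A *v (q - p))" for n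
      using \<rho> by (simp add: dist_norm matrix_vector_right_distrib matrix_vector_mult_scaleR)
    show "R i = r\<^sub>1 \<or> R i = r\<^sub>2" for i
      by (auto simp: R_def)
    show "covering_exponent s E"
      using null_measure_imp_covering_exponent s by blast
  qed (use assms A p points \<rho> s \<open>2 * s < 1\<close> \<open>A *v (q - p) \<noteq> 0\<close> in \<open>auto simp: \<rho>_def\<close>)
qed

end
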